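(* There is an absolute constant $C>0$ such that for all integers $k\ge m\ge 1$, \[ \delta(m,k)=\frac{(\log 2m)^{\theta}}{\left(\frac{k}{m}\log\log\frac{3k}{m}\right)^{m-1}} \] for some real number $\theta=\theta(m,k)$ with $|\theta|\le Cm$.
   Context: A set of integers is admissible if for every prime $p$ its elements do not cover all residue classes modulo $p$. For integers $k\ge m\ge1$, a set $A\subset\mathbb{Z}^m$ is called $(m,k)$-plausible if: (i) it is translation-invariant: $(h_1,\dots,h_m)\in A$ and $t\in\mathbb{Z}$ imply $(h_1+t,\dots,h_m+t)\in A$; (ii) it is permutation-invariant: $(h_1,\dots,h_m)\in A$ and $\sigma\in S_m$ imply $(h_{\sigma(1)},\dots,h_{\sigma(m)})\in A$; (iii) for every admissible set $\{x_1,\dots,x_k\}$ of $k$ distinct integers there exist distinct $h_1,\dots,h_m\in\{x_1,\dots,x_k\}$ with $(h_1,\dots,h_m)\in A$. Define \[ \delta(m,k)=\inf\left\{\liminf_{N\to\infty}\frac{|A\cap[-N,N]^m|}{(2N)^m}: A\subset\mathbb{Z}^m \text{ is } (m,k)\text{-plausible}\right\}. \] *)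

theory Defs
  imports "HOL-Analysis.Analysis" "HOL-Number_Theory.Number_Theory"
begin

definition admissible :: "int set \<Rightarrow> bool" where
  "admissible X \<longleftrightarrow> (\<forall>p::nat. prime p \<longrightarrow> (\<exists>a::int. \<forall>x\<in>X. \<not> [x = a] (mod int p)))"

text \<open>
  Points of $\mathbb{Z}^m$ are the extensional functions in \<open>{1..m} \<rightarrow>\<^sub>E UNIV\<close>.
  If \<open>\<sigma>\<close> permutes \<open>{1..m}\<close>, it is the identity elsewhere,
  so \<open>h \<circ> \<sigma>\<close> is again extensional.
\<close>

definition plausible :: "nat \<Rightarrow> nat \<Rightarrow> (nat \<Rightarrow> int) set \<Rightarrow> bool" where
  "plausible m k A \<longleftrightarrow>
     A \<subseteq> ({1..m} \<rightarrow>\<^sub>E UNIV) \<and>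
     (\<forall>h\<in>A. \<forall>t::int. (\<lambda>i\<in>{1..m}. h i + t) \<in> A) \<and>
     (\<forall>h\<in>A. \<forall>\<sigma>. \<sigma> permutes {1..m} \<longrightarrow> h \<circ> \<sigma> \<in> A) \<and>
     (\<forall>X. finite X \<and> card X = k \<and> admissible X \<longrightarrow>
        (\<exists>h\<in>A. inj_on h {1..m} \<and> h ` {1..m} \<subseteq> X))"

definition lower_density :: "nat \<Rightarrow> (nat \<Rightarrow> int) set \<Rightarrow> ereal" where
  "lower_density m A =
     liminf (\<lambda>N::nat. ereal (real (card (A \<inter> ({1..m} \<rightarrow>\<^sub>E {- int N..int N}))) / (2 * real N) ^ m))"

text \<open>
  Extended reals make \<open>liminf\<close> and \<open>INF\<close> total. For \<open>m \<ge> 1\<close> the value lies between 0 and 1: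
  the quotients are at most \<open>((2 * N + 1) / (2 * N)) ^ m\<close> for \<open>N \<ge> 1\<close>,
  and for \<open>m \<le> k\<close> all of $\mathbb{Z}^m$ is plausible.
\<close>

definition delta :: "nat \<Rightarrow> nat \<Rightarrow> ereal" where
  "delta m k = (INF A\<in>{A. plausible m k A}. lower_density m A)"

end

theory Submission imports Defs begin

text \<open>
  Write \<open>K = k / m\<close>. For the upper bound take the tuples whose entries are all congruent modulo
  \<open>q = r \<Prod>\<^bsub>p \<le> y\<^esub> p\<close>. An admissible set meets at most \<open>r \<Prod>\<^bsub>p \<le> y\<^esub> (p - 1)\<close> classes modulo \<open>q\<close>, so
  by pigeonhole this set is plausible as soon as \<open>r \<Prod>\<^bsub>p \<le> y\<^esub> (p - 1) \<le> (k - 1) / (m - 1)\<close>, and with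
  \<open>y\<close> about \<open>sqrt (ln K)\<close> one gains the factor \<open>\<Prod>\<^bsub>p \<le> y\<^esub> p / (p - 1) \<ge> c ln ln K\<close> in \<open>q\<close>.

  For the lower bound remove one residue class modulo every prime \<open>p \<le> k\<close> from a long interval, so
  that every \<open>k\<close>-subset of what remains is admissible, and choose \<open>2 k\<close> of the remaining points at
  random. A pair colliding modulo more than \<open>W\<close> (about \<open>ln k\<close>) of these primes is very rare. For an
  \<open>m\<close>-set without such pairs, the correlation of its points in the sieved interval is at most
  \<open>(C ln (m W)) ^ (m - 1)\<close> by the upper bound in Mertens' theorem, and \<open>ln (m W)\<close> is
  at most a multiple of \<open>ln (2 m) ln ln (3 K)\<close>. If \<open>A\<close> were too sparse, deleting a point from each rare
  pair and from each \<open>m\<close>-set in \<open>A\<close> would leave an admissible \<open>k\<close>-set without an \<open>m\<close>-set in \<open>A\<close>.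
\<close>

section \<open>Sums of products over residue classes\<close>

lemma sum_residue_system:
  fixes g :: "int \<Rightarrow> real"
  assumes "M > 0"
  shows "(\<Sum>x\<in>{a..<a + M}. g (x mod M)) = (\<Sum>x\<in>{0..<M}. g x)"
proof (rule sum.reindex_bij_betw)
  have inj: "inj_on (\<lambda>x. x mod M) {a..<a + M}"
  proof (rule inj_onI)
    fix x y assume xy: "x \<in> {a..<a + M}" "y \<in> {a..<a + M}" "x mod M = y mod M"
    then have "M dvd x - y" by (simp add: mod_eq_dvd_iff)
    moreover have "\<bar>x - y\<bar> < M" using xy by auto
    ultimately show "x = y" using zdvd_imp_le[of M "\<bar>x - y\<bar>"] by fastforce
  qed
  have "(\<lambda>x. x mod M) ` {a..<a + M} = {0..<M}"
    by (rule card_subset_eq) (use assms in \<open>auto simp: card_image inj\<close>)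
  then show "bij_betw (\<lambda>x. x mod M) {a..<a + M} {0..<M}"
    using inj by (simp add: bij_betw_def)
qed

lemma sum_residue_systems:
  fixes g :: "int \<Rightarrow> real"
  assumes "M > 0"
  shows "(\<Sum>x\<in>{a..<a + int L * M}. g (x mod M)) = real L * (\<Sum>x\<in>{0..<M}. g x)"
proof (induction L)
  case (Suc L)
  have "{a..<a + int (Suc L) * M} = {a..<a + int L * M} \<union> {a + int L * M..<a + int L * M + M}"
    using mult_nonneg_nonneg[of "int L" M] assms by (auto simp: algebra_simps simp del: mult_nonneg_nonneg)
  then have "(\<Sum>x\<in>{a..<a + int (Suc L) * M}. g (x mod M)) =
      (\<Sum>x\<in>{a..<a + int L * M}. g (x mod M)) + (\<Sum>x\<in>{a + int L * M..<a + int L * M + M}. g (x mod M))"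
    by (simp add: sum.union_disjoint ivl_disj_int)
  then show ?case
    using Suc sum_residue_system[OF assms, of g "a + int L * M"] by (simp add: algebra_simps)
qed simp

text \<open>By the Chinese remainder theorem, \<open>x\<close> runs over one period of
  \<open>q * M\<close> exactly as its residue pair runs over the full grid, and the sum over a grid
  factors.\<close>

lemma sum_coprime_residues:
  fixes f h :: "int \<Rightarrow> real"
  assumes "q > 0" "M > 0" "coprime q M"
  shows "(\<Sum>x\<in>{0..<q * M}. f (x mod q) * h (x mod M)) = (\<Sum>x\<in>{0..<q}. f x) * (\<Sum>x\<in>{0..<M}. h x)"
proof -
  let ?r = "\<lambda>x. (x mod q, x mod M)"
  have inj: "inj_on ?r {0..<q * M}"
  proof (rule inj_onI)
    fix x y assume xy: "x \<in> {0..<q * M}" "y \<in> {0..<q * M}" "?r x = ?r y"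
    then have "[x = y] (mod q * M)"
      using assms(3) by (intro coprime_cong_mult) (auto simp: cong_def)
    then show "x = y" using xy by (auto simp: cong_def)
  qed
  have "?r ` {0..<q * M} = {0..<q} \<times> {0..<M}"
    by (rule card_subset_eq) (use assms in \<open>auto simp: card_image inj nat_mult_distrib\<close>)
  with inj have "bij_betw ?r {0..<q * M} ({0..<q} \<times> {0..<M})"
    by (simp add: bij_betw_def)
  then have "(\<Sum>x\<in>{0..<q * M}. (\<lambda>(u, v). f u * h v) (?r x)) = (\<Sum>(u, v)\<in>{0..<q} \<times> {0..<M}. f u * h v)"
    by (rule sum.reindex_bij_betw)
  then show ?thesis
    by (simp add: sum.cartesian_product[symmetric] sum_product)
qed

text \<open>One prime at a time is split off by the Chinese remainder theorem. Over a whole number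
  \<open>L\<close> of periods the residues modulo distinct primes are exactly independent, so the
  sieve counts built on this carry no error term.\<close>

lemma sum_prod_residues:
  fixes F :: "nat \<Rightarrow> int \<Rightarrow> real"
  assumes "finite P" "\<forall>p\<in>P. prime p"
  shows "(\<Sum>x\<in>{a..<a + int L * int (\<Prod>P)}. \<Prod>p\<in>P. F p (x mod int p)) =
    real L * (\<Prod>p\<in>P. \<Sum>c\<in>{0..<int p}. F p c)"
proof -
  have pos: "int (\<Prod>P) > 0" if "\<forall>p\<in>P. prime p" for P :: "nat set"
    using that by (auto intro!: prod_pos simp: prime_gt_0_nat)
  have "(\<Sum>x\<in>{0..<int (\<Prod>P)}. \<Prod>p\<in>P. F p (x mod int p)) = (\<Prod>p\<in>P. \<Sum>c\<in>{0..<int p}. F p c)"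
    using assms
  proof (induction P rule: finite_induct)
    case (insert q P)
    have cop: "coprime (int q) (int (\<Prod>P))"
      using insert by (auto intro!: prod_coprime_right primes_coprime)
    have "(\<Sum>x\<in>{0..<int (\<Prod>(insert q P))}. \<Prod>p\<in>insert q P. F p (x mod int p)) =
      (\<Sum>x\<in>{0..<int q * int (\<Prod>P)}. F q (x mod int q) * (\<Prod>p\<in>P. F p ((x mod int (\<Prod>P)) mod int p)))"
      using insert by (intro sum.cong) (auto intro!: prod.cong arg_cong[of _ _ "F _"] simp: mod_mod_cancel dvd_prodI)
    also have "\<dots> = (\<Sum>c\<in>{0..<int q}. F q c) * (\<Sum>x\<in>{0..<int (\<Prod>P)}. \<Prod>p\<in>P. F p (x mod int p))"
      using insert.prems pos[of P] cop by (intro sum_coprime_residues) (auto simp: prime_gt_0_nat)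
    finally show ?case using insert by simp
  qed simp
  moreover have "(\<Sum>x\<in>{a..<a + int L * int (\<Prod>P)}. \<Prod>p\<in>P. F p (x mod int p)) =
     (\<Sum>x\<in>{a..<a + int L * int (\<Prod>P)}. \<Prod>p\<in>P. F p ((x mod int (\<Prod>P)) mod int p))"
    using assms by (intro sum.cong prod.cong) (auto intro!: arg_cong[of _ _ "F _"] simp: mod_mod_cancel dvd_prodI)
  ultimately show ?thesis
    using sum_residue_systems[OF pos, of P "\<lambda>x. \<Prod>p\<in>P. F p (x mod int p)" a L] assms by simp
qed

text \<open>The indicator of avoiding every \<open>R p\<close> is a product of local indicators,
  each of which sums to \<open>p - card (R p)\<close> over one period.\<close>

lemma card_avoiding_residues:
  assumes "finite P" "\<forall>p\<in>P. prime p" "\<And>p. p \<in> P \<Longrightarrow> R p \<subseteq> {0..<int p}"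
  shows "real (card {x \<in> {a..<a + int L * int (\<Prod>P)}. \<forall>p\<in>P. x mod int p \<notin> R p}) =
    real L * (\<Prod>p\<in>P. real p - real (card (R p)))"
proof -
  let ?I = "{a..<a + int L * int (\<Prod>P)}"
  have ind: "(if \<forall>p\<in>P. x mod int p \<notin> R p then 1 else 0) =
      (\<Prod>p\<in>P. if x mod int p \<notin> R p then 1 else (0::real))" for x
    using assms(1) by (auto simp: prod_zero_iff)
  have "real (card {x \<in> ?I. \<forall>p\<in>P. x mod int p \<notin> R p}) = (\<Sum>x\<in>?I. if \<forall>p\<in>P. x mod int p \<notin> R p then 1 else 0)"
    by (simp add: sum.If_cases Int_def)
  also have "\<dots> = real L * (\<Prod>p\<in>P. \<Sum>c\<in>{0..<int p}. if c \<notin> R p then 1 else 0)"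
    unfolding ind using assms by (intro sum_prod_residues[of P "\<lambda>p c. if c \<notin> R p then 1 else 0"]) auto
  also have "(\<Prod>p\<in>P. \<Sum>c\<in>{0..<int p}. if c \<notin> R p then 1 else 0) = (\<Prod>p\<in>P. real p - real (card (R p)))"
  proof (rule prod.cong[OF refl])
    fix p assume p: "p \<in> P"
    have fin: "finite (R p)" using assms(3)[OF p] by (rule finite_subset) simp
    have "{0..<int p} \<inter> {c. c \<notin> R p} = {0..<int p} - R p" by auto
    moreover have "card (R p) \<le> card {0..<int p}" using assms(3)[OF p] by (intro card_mono) auto
    ultimately show "(\<Sum>c\<in>{0..<int p}. if c \<notin> R p then 1 else (0::real)) = real p - real (card (R p))"
      using assms(3)[OF p] fin by (simp add: sum.If_cases card_Diff_subset of_nat_diff)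
  qed
  finally show ?thesis .
qed

section \<open>Mertens-type bounds\<close>

abbreviation primes_upto :: "nat \<Rightarrow> nat set" where
  "primes_upto k \<equiv> {p. prime p \<and> p \<le> k}"

lemma finite_primes_le: "finite {p::nat. prime p \<and> p \<le> n}"
  by (rule finite_subset[of _ "{..n}"]) auto

lemma prime_gt_1_real: "prime (p::nat) \<Longrightarrow> 1 < real p"
  using prime_gt_1_nat by simp

section \<open>Lower bound: harmonic sums below Euler products\<close>

text \<open>The terms lost when \<open>q\<close> joins \<open>P\<close> are multiples
  \<open>q * n'\<close> with \<open>n'\<close> again in the old range, so they sum to at most a
  \<open>1 / q\<close> share of the old sum. Solving \<open>a \<le> a / q + b\<close> for
  \<open>a\<close> gives the factor.\<close>

lemma sum_recip_coprime_step:
  fixes P :: "nat set"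
  assumes "prime q"
  shows "(\<Sum>n | n \<in> {1..N} \<and> (\<forall>p\<in>P. \<not> p dvd n). 1 / real n) \<le>
    real q / (real q - 1) * (\<Sum>n | n \<in> {1..N} \<and> (\<forall>p\<in>insert q P. \<not> p dvd n). 1 / real n)"
proof -
  let ?A = "{n. n \<in> {1..N} \<and> (\<forall>p\<in>P. \<not> p dvd n)}"
  let ?B = "{n. n \<in> {1..N} \<and> (\<forall>p\<in>insert q P. \<not> p dvd n)}"
  have q: "real q > 1" using assms by (rule prime_gt_1_real)
  have fin: "finite ?A" "finite ?B" by auto
  have sub: "?A - ?B \<subseteq> (\<lambda>n. q * n) ` ?A"
  proof
    fix n assume n: "n \<in> ?A - ?B"
    then obtain n' where n': "n = q * n'" by (auto elim: dvdE)
    moreover have "n' \<in> ?A" using n n' q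
      by (auto intro: order_trans[of n' "q * n'"])
    ultimately show "n \<in> (\<lambda>n. q * n) ` ?A" by blast
  qed
  have "(\<Sum>n\<in>?A. 1 / real n) = (\<Sum>n\<in>?A - ?B. 1 / real n) + (\<Sum>n\<in>?B. 1 / real n)"
    by (intro sum.subset_diff) auto
  also have "(\<Sum>n\<in>?A - ?B. 1 / real n) \<le> (\<Sum>n\<in>(\<lambda>n. q * n) ` ?A. 1 / real n)"
    using sub fin by (intro sum_mono2) auto
  also have "\<dots> = (\<Sum>n\<in>?A. 1 / real n) / real q"
  proof -
    have "inj_on (\<lambda>n. q * n) ?A" using q by (intro inj_onI) auto
    then have "(\<Sum>n\<in>(\<lambda>n. q * n) ` ?A. 1 / real n) = (\<Sum>n\<in>?A. 1 / real (q * n))"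
      by (simp add: sum.reindex)
    also have "\<dots> = (\<Sum>n\<in>?A. 1 / real n / real q)"
      by (rule sum.cong) (simp_all add: mult.commute)
    finally show ?thesis by (simp only: sum_divide_distrib)
  qed
  finally have *: "(\<Sum>n\<in>?A. 1 / real n) \<le> (\<Sum>n\<in>?A. 1 / real n) / real q + (\<Sum>n\<in>?B. 1 / real n)"
    by simp
  have "a \<le> r / (r - 1) * b" if "a \<le> a / r + b" "r > 1" for a b r :: real
    using that by (simp add: field_simps)
  from this[OF * q] show ?thesis .
qed

text \<open>Once all primes up to \<open>N\<close> have been removed, only the term
  \<open>n = 1\<close> is left.\<close>

lemma harmonic_sum_le_euler_product:
  "(\<Sum>n=1..N. 1 / real n) \<le> (\<Prod>p | prime p \<and> p \<le> N. real p / (real p - 1))"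
proof -
  let ?S = "\<lambda>P::nat set. \<Sum>n | n \<in> {1..N} \<and> (\<forall>p\<in>P. \<not> p dvd n). 1 / real n"
  have *: "(\<Sum>n=1..N. 1 / real n) \<le> (\<Prod>p\<in>P. real p / (real p - 1)) * ?S P"
    if "finite P" "\<forall>p\<in>P. prime p" for P
    using that
  proof (induction P rule: finite_induct)
    case empty
    then show ?case by (simp add: atLeastAtMost_def atLeast_def atMost_def Int_def conj_commute)
  next
    case (insert q P)
    have "(\<Prod>p\<in>P. real p / (real p - 1)) \<ge> 0"
      using insert by (intro prod_nonneg) (auto dest!: prime_gt_1_real)
    then have "(\<Prod>p\<in>P. real p / (real p - 1)) * ?S P \<le>
        (\<Prod>p\<in>P. real p / (real p - 1)) * (real q / (real q - 1) * ?S (insert q P))"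
      using insert by (intro mult_left_mono sum_recip_coprime_step) auto
    with insert show ?case by (simp add: mult_ac)
  qed
  let ?P = "{p::nat. prime p \<and> p \<le> N}"
  have "?S ?P \<le> (\<Sum>n\<in>{1::nat}. 1 / real n)"
  proof (rule sum_mono2)
    show "{n. n \<in> {1..N} \<and> (\<forall>p\<in>?P. \<not> p dvd n)} \<subseteq> {1}"
    proof clarsimp
      fix n assume n: "Suc 0 \<le> n" "n \<le> N" "\<forall>p. prime p \<and> p \<le> N \<longrightarrow> \<not> p dvd n"
      show "n = Suc 0"
      proof (rule ccontr)
        assume "n \<noteq> Suc 0"
        then obtain p where "prime p" "p dvd n" using prime_factor_nat[of n] by auto
        then show False using n dvd_imp_le[of p n] by auto
      qed
    qed
  qed auto
  moreover have "(\<Prod>p\<in>?P. real p / (real p - 1)) \<ge> 0"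
    by (intro prod_nonneg) (auto dest!: prime_gt_1_real)
  ultimately have "(\<Prod>p\<in>?P. real p / (real p - 1)) * ?S ?P \<le> (\<Prod>p\<in>?P. real p / (real p - 1)) * 1"
    by (intro mult_left_mono) auto
  with *[OF finite_primes_le[of N]] show ?thesis by simp
qed

section \<open>Upper bound: the zeta function slightly to the right of 1\<close>

text \<open>The bound is one plus the integral of \<open>x powr - (1 + \<sigma>)\<close> from 1 to
  \<open>N + 1\<close>. Calculus is avoided by telescoping:
  \<open>1 + \<sigma> / x \<le> (1 - 1 / x) powr - \<sigma>\<close> bounds each new term by a
  difference of consecutive values of the antiderivative.\<close>

lemma sum_powr_le:
  assumes "\<sigma> > 0"
  shows "(\<Sum>n=1..Suc N. real n powr - (1 + \<sigma>)) \<le> 1 + (1 - real (Suc N) powr - \<sigma>) / \<sigma>"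
proof (induction N)
  case (Suc N)
  define x where "x = real (Suc (Suc N))"
  have x: "x > 1" by (simp add: x_def)
  have "\<sigma> * ln (1 - 1 / x) \<le> \<sigma> * (- 1 / x)"
    using ln_le_minus_one[of "1 - 1 / x"] x assms by (intro mult_left_mono) auto
  then have "1 + \<sigma> / x \<le> 1 - \<sigma> * ln (1 - 1 / x)" by simp
  also have "\<dots> \<le> exp (- \<sigma> * ln (1 - 1 / x))"
    using exp_ge_add_one_self[of "- \<sigma> * ln (1 - 1 / x)"] by simp
  also have "\<dots> = (1 - 1 / x) powr - \<sigma>"
    using x by (simp add: powr_def)
  finally have "x powr - \<sigma> * (1 + \<sigma> / x) \<le> x powr - \<sigma> * (1 - 1 / x) powr - \<sigma>"
    by (intro mult_left_mono) auto
  also have "\<dots> = real (Suc N) powr - \<sigma>"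
    using x by (subst powr_mult[symmetric]) (auto simp: algebra_simps x_def)
  finally have "\<sigma> * x powr - (1 + \<sigma>) \<le> real (Suc N) powr - \<sigma> - x powr - \<sigma>"
    using x by (simp add: algebra_simps powr_diff powr_minus powr_add field_simps)
  then have "x powr - (1 + \<sigma>) \<le> (real (Suc N) powr - \<sigma> - x powr - \<sigma>) / \<sigma>"
    using assms by (simp add: field_simps)
  with Suc show ?case by (simp add: x_def diff_divide_distrib)
qed simp

lemma
  assumes "\<sigma> > 0"
  shows summable_on_powr: "(\<lambda>n. real n powr - (1 + \<sigma>)) summable_on {1..}"
    and infsum_powr_le: "(\<Sum>\<^sub>\<infinity>n\<in>{1..}. real n powr - (1 + \<sigma>)) \<le> 1 + 1 / \<sigma>"
proof -
  have fin: "(\<Sum>n\<in>F. real n powr - (1 + \<sigma>)) \<le> 1 + 1 / \<sigma>" if F: "finite F" "F \<subseteq> {1..}" for F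
  proof -
    have "F \<subseteq> {1..Suc (Max F)}"
      using F Max_ge[OF F(1)] by (force intro: le_SucI)
    then have "(\<Sum>n\<in>F. real n powr - (1 + \<sigma>)) \<le> (\<Sum>n=1..Suc (Max F). real n powr - (1 + \<sigma>))"
      by (intro sum_mono2) auto
    also have "\<dots> \<le> 1 + (1 - real (Suc (Max F)) powr - \<sigma>) / \<sigma>"
      by (rule sum_powr_le[OF assms])
    also have "\<dots> \<le> 1 + 1 / \<sigma>" using assms by (simp add: divide_right_mono)
    finally show ?thesis .
  qed
  show summ: "(\<lambda>n. real n powr - (1 + \<sigma>)) summable_on {1..}"
  proof (rule nonneg_bdd_above_summable_on)
    show "bdd_above (sum (\<lambda>n. real n powr - (1 + \<sigma>)) ` {F. F \<subseteq> {1..} \<and> finite F})"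
      using fin by (intro bdd_aboveI[of _ "1 + 1 / \<sigma>"]) blast
  qed auto
  show "(\<Sum>\<^sub>\<infinity>n\<in>{1..}. real n powr - (1 + \<sigma>)) \<le> 1 + 1 / \<sigma>"
    using summ fin by (rule infsum_le_finite_sums)
qed

text \<open>Over all positive integers the multiples of \<open>q\<close> form an exact dilate of the
  set coprime to \<open>P\<close>, so the finite inequality becomes an identity: one Euler factor at
  the exponent \<open>1 + \<sigma>\<close>.\<close>

lemma infsum_coprime_step:
  fixes P :: "nat set"
  assumes "\<sigma> > 0" "prime q" "\<forall>p\<in>P. prime p" "q \<notin> P"
  shows "(\<Sum>\<^sub>\<infinity>n | n \<ge> 1 \<and> (\<forall>p\<in>insert q P. \<not> p dvd n). real n powr - (1 + \<sigma>)) =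
    (1 - real q powr - (1 + \<sigma>)) * (\<Sum>\<^sub>\<infinity>n | n \<ge> 1 \<and> (\<forall>p\<in>P. \<not> p dvd n). real n powr - (1 + \<sigma>))"
proof -
  let ?f = "\<lambda>n::nat. real n powr - (1 + \<sigma>)"
  let ?A = "{n. n \<ge> 1 \<and> (\<forall>p\<in>P. \<not> p dvd n)}"
  let ?B = "{n. n \<ge> 1 \<and> (\<forall>p\<in>insert q P. \<not> p dvd n)}"
  have summ: "?f summable_on X" if "X \<subseteq> {1..}" for X
    using summable_on_subset_banach[OF summable_on_powr[OF assms(1)] that] .
  have q: "q > 0" using assms(2) by (rule prime_gt_0_nat)
  have pq: "\<not> p dvd q" if "p \<in> P" for p
    using that assms primes_dvd_imp_eq by blast
  have split: "?A = ?B \<union> (\<lambda>n. q * n) ` ?A"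
  proof (intro equalityI subsetI)
    fix n assume n: "n \<in> ?A"
    show "n \<in> ?B \<union> (\<lambda>n. q * n) ` ?A"
    proof (cases "q dvd n")
      case True
      then obtain n' where "n = q * n'" by (elim dvdE)
      with n have "n' \<in> ?A" by auto
      with \<open>n = q * n'\<close> show ?thesis by blast
    qed (use n in auto)
  next
    fix n assume "n \<in> ?B \<union> (\<lambda>n. q * n) ` ?A"
    then show "n \<in> ?A" using q pq assms(3) by (auto simp: prime_dvd_mult_iff)
  qed
  have "infsum ?f (?B \<union> (\<lambda>n. q * n) ` ?A) = infsum ?f ?B + infsum ?f ((\<lambda>n. q * n) ` ?A)"
  proof (rule infsum_Un_disjoint)
    show "?f summable_on ?B" "?f summable_on (\<lambda>n. q * n) ` ?A"
      using q by (rule_tac [!] summ) auto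
  qed auto
  then have "infsum ?f ?A = infsum ?f ?B + infsum ?f ((\<lambda>n. q * n) ` ?A)"
    unfolding split[symmetric] .
  also have "infsum ?f ((\<lambda>n. q * n) ` ?A) = infsum (\<lambda>n. ?f q * ?f n) ?A"
    using q by (subst infsum_reindex) (auto intro!: inj_onI infsum_cong simp: powr_mult)
  also have "\<dots> = ?f q * infsum ?f ?A"
    by (intro infsum_cmult_right summ) auto
  finally show ?thesis by (simp add: algebra_simps)
qed

text \<open>The Euler factors times the full zeta sum equal the sum over integers free of primes in
  \<open>P\<close>, which contains the term \<open>n = 1\<close>. Read as an upper bound for the
  inverse Euler product at \<open>1 + \<sigma>\<close>.\<close>

lemma euler_product_le_infsum:
  assumes "\<sigma> > 0" "finite P" "\<forall>p\<in>P. prime (p::nat)"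
  shows "1 \<le> (\<Prod>p\<in>P. 1 - real p powr - (1 + \<sigma>)) * (1 + 1 / \<sigma>)"
proof -
  let ?f = "\<lambda>n::nat. real n powr - (1 + \<sigma>)"
  let ?A = "\<lambda>P. {n. n \<ge> 1 \<and> (\<forall>p\<in>P. \<not> p dvd n)}"
  have eq: "infsum ?f (?A P) = (\<Prod>p\<in>P. 1 - ?f p) * infsum ?f {1..}"
    using assms(2,3)
  proof (induction P rule: finite_induct)
    case (insert q P)
    then show ?case using infsum_coprime_step[OF assms(1), of q P] by (simp add: mult.assoc)
  qed (simp add: atLeast_def)
  have "1 = infsum ?f {1}" by simp
  also have "\<dots> \<le> infsum ?f (?A P)"
    using assms by (intro infsum_mono2 summable_on_subset_banach[OF summable_on_powr]) auto
  also have "\<dots> \<le> (\<Prod>p\<in>P. 1 - ?f p) * (1 + 1 / \<sigma>)"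
  proof -
    have "?f p \<le> 1" if "p \<in> P" for p
      using that assms prime_ge_1_nat[of p] powr_mono[of "- (1 + \<sigma>)" 0 "real p"] by auto
    then show ?thesis unfolding eq
      using infsum_powr_le[OF assms(1)] by (intro mult_left_mono prod_nonneg) auto
  qed
  finally show ?thesis .
qed

section \<open>A one-sided form of Mertens' first theorem\<close>

lemma sum_ln_prime_divisors_le:
  assumes "n > 0"
  shows "(\<Sum>p | prime p \<and> p dvd n. ln (real p)) \<le> ln (real n)"
proof -
  have eq: "{p. prime p \<and> p dvd n} = prime_factors n"
    using assms by (auto simp: prime_factors_dvd)
  have pos: "p > 0" if "p \<in> prime_factors n" for p
    using that by (auto dest: in_prime_factors_imp_prime prime_gt_0_nat)
  have "(\<Sum>p | prime p \<and> p dvd n. ln (real p)) = ln (\<Prod>p\<in>prime_factors n. real p)"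
    unfolding eq by (subst ln_prod) (auto simp: pos)
  also have "\<dots> \<le> ln (\<Prod>p\<in>prime_factors n. real (p ^ multiplicity p n))"
  proof (rule ln_mono)
    show "(\<Prod>p\<in>prime_factors n. real p) \<le> (\<Prod>p\<in>prime_factors n. real (p ^ multiplicity p n))"
    proof (rule prod_mono, safe)
      fix p assume p: "p \<in># prime_factorization n"
      then have "multiplicity p n \<ge> 1" "p \<ge> 1"
        using prime_factors_multiplicity[of n] prime_ge_1_nat by (force simp: in_prime_factors_iff)+
      then show "real p \<le> real (p ^ multiplicity p n)" using power_increasing[of 1 "multiplicity p n" p] by simp
    qed simp
  qed (auto intro!: prod_pos simp: pos)
  also have "(\<Prod>p\<in>prime_factors n. real (p ^ multiplicity p n)) = real n"
    using prime_factorization_nat[of n] assms by (metis of_nat_prod)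
  finally show ?thesis .
qed

lemma card_multiples:
  assumes "d > 0"
  shows "card {j\<in>{1..n::nat}. d dvd j} = n div d"
proof -
  have "{j\<in>{1..n}. d dvd j} = (\<lambda>i. d * i) ` {1..n div d}"
  proof (intro equalityI subsetI)
    fix j assume "j \<in> {j\<in>{1..n}. d dvd j}"
    then obtain i where "j = d * i" "1 \<le> j" "j \<le> n" by (auto elim: dvdE)
    then show "j \<in> (\<lambda>i. d * i) ` {1..n div d}"
      using assms by (auto simp: less_eq_div_iff_mult_less_eq mult.commute intro!: image_eqI[of _ _ i])
  qed (use assms in \<open>auto simp: less_eq_div_iff_mult_less_eq mult.commute\<close>)
  then show ?thesis using assms by (simp add: card_image inj_on_def)
qed

text \<open>Factorial argument: the sum of \<open>ln p\<close> over pairs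
  \<open>p dvd j \<le> n\<close> is at most \<open>ln (fact n)\<close>, hence at most
  \<open>n * ln n\<close>, and each prime occurs \<open>n div p\<close> times. The factor 2 comes
  from \<open>n / p \<le> 2 * (n div p)\<close> for \<open>p \<le> n\<close>.\<close>

lemma sum_ln_primes_div_le:
  assumes "n > 0"
  shows "(\<Sum>p | prime p \<and> p \<le> n. ln (real p) / real p) \<le> 2 * ln (real n)"
proof -
  let ?P = "{p::nat. prime p \<and> p \<le> n}"
  have "real n * (\<Sum>p\<in>?P. ln (real p) / real p) \<le> (\<Sum>p\<in>?P. 2 * (real (n div p) * ln (real p)))"
    unfolding sum_distrib_left
  proof (rule sum_mono)
    fix p assume p: "p \<in> ?P"
    then have "p > 0" "p \<le> n" "1 < real p" using prime_gt_1_nat[of p] by (auto simp: prime_gt_0_nat)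
    have "n div p \<ge> 1" using \<open>p > 0\<close> \<open>p \<le> n\<close> by (simp add: less_eq_div_iff_mult_less_eq)
    then have "p * 1 \<le> p * (n div p)" by (intro mult_left_mono) auto
    moreover have "n = p * (n div p) + n mod p" by simp
    moreover have "n mod p < p" using \<open>p > 0\<close> by simp
    ultimately have "n \<le> 2 * (p * (n div p))" by linarith
    then have "real n \<le> 2 * (real p * real (n div p))"
      by (metis of_nat_le_iff of_nat_mult of_nat_numeral)
    then have "real n / real p \<le> 2 * real (n div p)"
      using \<open>p > 0\<close> by (simp add: field_simps)
    then have "real n / real p * ln (real p) \<le> 2 * real (n div p) * ln (real p)"
      using \<open>1 < real p\<close> by (intro mult_right_mono) auto
    then show "real n * (ln (real p) / real p) \<le> 2 * (real (n div p) * ln (real p))" by simp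
  qed
  also have "\<dots> = 2 * (\<Sum>p\<in>?P. \<Sum>j | j \<in> {1..n} \<and> p dvd j. ln (real p))"
    unfolding sum_distrib_left[symmetric]
    by (auto intro!: sum.cong simp: card_multiples[symmetric] prime_gt_0_nat)
  also have "(\<Sum>p\<in>?P. \<Sum>j | j \<in> {1..n} \<and> p dvd j. ln (real p)) =
      (\<Sum>j\<in>{1..n}. \<Sum>p | p \<in> ?P \<and> p dvd j. ln (real p))"
    by (rule sum.swap_restrict) (auto simp: finite_primes_le)
  also have "\<dots> \<le> (\<Sum>j\<in>{1..n}. ln (real n))"
  proof (rule sum_mono)
    fix j assume j: "j \<in> {1..n}"
    have "p \<le> n" if "p dvd j" for p using dvd_imp_le[OF that] j by auto
    then have "{p. p \<in> ?P \<and> p dvd j} = {p. prime p \<and> p dvd j}" by auto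
    then have "(\<Sum>p | p \<in> ?P \<and> p dvd j. ln (real p)) \<le> ln (real j)"
      using sum_ln_prime_divisors_le[of j] j by simp
    also have "\<dots> \<le> ln (real n)" using j by simp
    finally show "(\<Sum>p | p \<in> ?P \<and> p dvd j. ln (real p)) \<le> ln (real n)" .
  qed
  also have "\<dots> = real n * ln (real n)" by simp
  finally have "real n * (\<Sum>p\<in>?P. ln (real p) / real p) \<le> real n * (2 * ln (real n))" by simp
  with assms show ?thesis by simp
qed

text \<open>The Euler factors at exponent 1 are compared with those at \<open>1 + \<sigma>\<close>,
  whose product is controlled by zeta. Each ratio is at most
  \<open>exp (2 * \<sigma> * ln p / p)\<close>, so Mertens' first theorem bounds the total
  change.\<close>

lemma euler_product_le_ln:
  assumes "t > 0"
  shows "(\<Prod>p | prime p \<and> p \<le> t. real p / (real p - 1)) \<le> exp 4 * (1 + ln (real t))"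
proof (cases "t = 1")
  case True
  then have none: "{p::nat. prime p \<and> p \<le> t} = {}" by (auto dest: prime_ge_2_nat)
  show ?thesis unfolding none using True by simp
next
  case False
  then have t: "real t > 1" using assms by simp
  \<comment> \<open>This choice balances both sides: the comparison costs
    \<open>exp (4 * \<sigma> * ln t) = exp 4\<close>, and \<open>1 + 1 / \<sigma>\<close> becomes
    \<open>1 + ln t\<close>.\<close>
  define \<sigma> where "\<sigma> = 1 / ln (real t)"
  have \<sigma>: "\<sigma> > 0" using t by (simp add: \<sigma>_def)
  let ?P = "{p::nat. prime p \<and> p \<le> t}"
  let ?f = "\<lambda>p. real p powr - (1 + \<sigma>)"
  have pos: "1 - ?f p > 0" if "prime p" for p
    using powr_less_mono[of "- (1 + \<sigma>)" 0 "real p"] that \<sigma> prime_gt_1_real[OF that] by auto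
  have "(\<Prod>p\<in>?P. real p / (real p - 1)) * (\<Prod>p\<in>?P. 1 - ?f p) = (\<Prod>p\<in>?P. real p / (real p - 1) * (1 - ?f p))"
    by (simp only: prod.distrib)
  also have "\<dots> \<le> (\<Prod>p\<in>?P. exp (2 * \<sigma> * (ln (real p) / real p)))"
  proof (rule prod_mono, safe)
    fix p :: nat assume "prime p" "p \<le> t"
    then have p: "real p \<ge> 2" using prime_ge_2_nat by simp
    show "0 \<le> real p / (real p - 1) * (1 - ?f p)" using pos[OF \<open>prime p\<close>] p by simp
    have "1 - real p powr - \<sigma> \<le> \<sigma> * ln (real p)"
      using exp_ge_add_one_self[of "- \<sigma> * ln (real p)"] p by (simp add: powr_def)
    have "real p / (real p - 1) * (1 - ?f p) = 1 + (1 - real p powr - \<sigma>) / (real p - 1)"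
      using p by (simp add: field_simps powr_add powr_minus powr_diff)
    also have "\<dots> \<le> 1 + \<sigma> * ln (real p) / (real p - 1)"
      using \<open>1 - real p powr - \<sigma> \<le> _\<close> p by (simp add: divide_right_mono)
    also have "\<dots> \<le> 1 + \<sigma> * ln (real p) / (real p / 2)"
      using p \<sigma> by (intro add_left_mono divide_left_mono) auto
    also have "\<dots> \<le> exp (\<sigma> * ln (real p) / (real p / 2))" by (rule exp_ge_add_one_self)
    finally show "real p / (real p - 1) * (1 - ?f p) \<le> exp (2 * \<sigma> * (ln (real p) / real p))"
      by (simp add: mult_ac)
  qed
  also have "\<dots> = exp (2 * \<sigma> * (\<Sum>p\<in>?P. ln (real p) / real p))"
    by (simp add: exp_sum[OF finite_primes_le, symmetric] sum_distrib_left)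
  also have "\<dots> \<le> exp (2 * \<sigma> * (2 * ln (real t)))"
    using sum_ln_primes_div_le[of t] assms \<sigma> by (intro iffD2[OF exp_le_cancel_iff] mult_left_mono) auto
  also have "\<dots> = exp 4" using t by (simp add: \<sigma>_def)
  finally have *: "(\<Prod>p\<in>?P. real p / (real p - 1)) * (\<Prod>p\<in>?P. 1 - ?f p) \<le> exp 4" .
  have nn: "0 \<le> (\<Prod>p\<in>?P. real p / (real p - 1))"
    by (intro prod_nonneg) (auto dest!: prime_gt_1_real)
  have "(\<Prod>p\<in>?P. real p / (real p - 1)) * 1 \<le>
      (\<Prod>p\<in>?P. real p / (real p - 1)) * ((\<Prod>p\<in>?P. 1 - ?f p) * (1 + 1 / \<sigma>))"
    using euler_product_le_infsum[OF \<sigma> finite_primes_le] nn by (intro mult_left_mono) auto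
  also have "\<dots> \<le> exp 4 * (1 + 1 / \<sigma>)"
    using mult_right_mono[OF *, of "1 + 1 / \<sigma>"] \<sigma> by (simp add: mult.assoc)
  finally show ?thesis by (simp add: \<sigma>_def)
qed

text \<open>A set of \<open>t\<close> primes does worst when they are small. Those up to
  \<open>t\<close> fall under Mertens; the at most \<open>t\<close> others have factors below
  \<open>1 + 1 / t\<close>, which multiply to at most \<open>exp 1\<close>.\<close>

lemma prod_primes_card_le_ln:
  assumes "finite D" "\<forall>p\<in>D. prime (p::nat)" "card D \<le> t" "t > 0"
  shows "(\<Prod>p\<in>D. real p / (real p - 1)) \<le> exp 5 * (1 + ln (real t))"
proof -
  let ?P = "{p::nat. prime p \<and> p \<le> t}"
  let ?f = "\<lambda>p. real p / (real p - 1)"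
  have f1: "?f p \<ge> 1" if "prime p" for p using prime_gt_1_real[OF that] by simp
  have "prod ?f (D - ?P) \<le> (\<Prod>p\<in>D - ?P. exp (1 / real t))"
  proof (rule prod_mono, rule conjI)
    fix p assume p: "p \<in> D - ?P"
    then have pt: "real p \<ge> real t + 1" using assms(2) by auto
    show "0 \<le> ?f p" using f1[of p] p assms(2) by auto
    have "?f p = 1 + 1 / (real p - 1)" using pt assms(4) by (simp add: field_simps)
    also have "\<dots> \<le> 1 + 1 / real t" using pt assms(4) by (intro add_left_mono divide_left_mono) auto
    also have "\<dots> \<le> exp (1 / real t)" by (rule exp_ge_add_one_self)
    finally show "?f p \<le> exp (1 / real t)" .
  qed
  also have "\<dots> = exp (real (card (D - ?P)) / real t)"
    by (simp add: exp_of_nat_mult[symmetric])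
  also have "\<dots> \<le> exp 1"
  proof -
    have "card (D - ?P) \<le> t" using assms card_mono[of D "D - ?P"] by auto
    then show ?thesis using assms(4) by simp
  qed
  finally have 1: "prod ?f (D - ?P) \<le> exp 1" .
  have "prod ?f (D \<inter> ?P) \<le> prod ?f ?P"
    using f1 by (intro prod_mono2 finite_primes_le) (auto intro: order_trans[OF zero_le_one])
  then have 2: "prod ?f (D \<inter> ?P) \<le> exp 4 * (1 + ln (real t))"
    using euler_product_le_ln[OF assms(4)] by linarith
  have "prod ?f D = prod ?f (D - ?P) * prod ?f (D \<inter> ?P)"
    using assms(1) by (subst prod.union_disjoint[symmetric]) (auto intro: prod.cong)
  also have "\<dots> \<le> exp 1 * (exp 4 * (1 + ln (real t)))"
    using 1 2 assms(2) f1 by (intro mult_mono prod_nonneg) (auto intro: order_trans[OF zero_le_one])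
  also have "\<dots> = exp 5 * (1 + ln (real t))"
    by (simp add: mult.assoc[symmetric] exp_add[symmetric])
  finally show ?thesis .
qed

section \<open>The deletion method in a sieved interval\<close>

lemma card_supersets_of_card:
  assumes "finite S" "Y \<subseteq> S" "card Y \<le> n"
  shows "card {X. X \<subseteq> S \<and> card X = n \<and> Y \<subseteq> X} = (card S - card Y) choose (n - card Y)"
proof -
  have fin: "finite Y" using assms finite_subset by blast
  have "bij_betw (\<lambda>X. X - Y) {X. X \<subseteq> S \<and> card X = n \<and> Y \<subseteq> X} {Z. Z \<subseteq> S - Y \<and> card Z = n - card Y}"
  proof (rule bij_betwI[where g = "\<lambda>Z. Z \<union> Y"])
    show "(\<lambda>Z. Z \<union> Y) \<in> {Z. Z \<subseteq> S - Y \<and> card Z = n - card Y} \<rightarrow> {X. X \<subseteq> S \<and> card X = n \<and> Y \<subseteq> X}"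
    proof (safe del: subsetI)
      fix Z assume Z: "Z \<subseteq> S - Y" "card Z = n - card Y"
      then have "finite Z" using assms(1) finite_subset by blast
      then have "card (Z \<union> Y) = card Z + card Y" using Z fin by (intro card_Un_disjoint) auto
      then show "card (Z \<union> Y) = n" using Z assms(3) by simp
      show "Z \<union> Y \<subseteq> S" using Z assms(2) by auto
    qed simp
  qed (use assms fin in \<open>auto simp: card_Diff_subset\<close>)
  then have "card {X. X \<subseteq> S \<and> card X = n \<and> Y \<subseteq> X} = card {Z. Z \<subseteq> S - Y \<and> card Z = n - card Y}"
    by (rule bij_betw_same_card)
  also have "\<dots> = (card S - card Y) choose (n - card Y)"
    using n_subsets[of "S - Y" "n - card Y"] assms fin by (simp add: card_Diff_subset)
  finally show ?thesis .
qed

text \<open>The deletion method: a random \<open>n\<close>-subset contains on average at most \<open>n - k\<close> members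
  of \<open>F\<close>, and removing one point of each leaves \<open>k\<close> points.\<close>

lemma exists_subset_avoiding_family:
  assumes S: "finite S" and F: "F \<subseteq> Pow S" "\<And>Y. Y \<in> F \<Longrightarrow> Y \<noteq> {} \<and> card Y \<le> n"
    and kn: "k \<le> n" "n \<le> card S"
    and le: "(\<Sum>Y\<in>F. (card S - card Y) choose (n - card Y)) \<le> (n - k) * (card S choose n)"
  shows "\<exists>X\<subseteq>S. card X = k \<and> (\<forall>Y\<in>F. \<not> Y \<subseteq> X)"
proof -
  define N where "N = {X. X \<subseteq> S \<and> card X = n}"
  have finF: "finite F" using F(1) S by (meson finite_Pow_iff finite_subset)
  have finN: "finite N" unfolding N_def using S by (intro finite_subset[OF _ finite_Pow_iff[THEN iffD2, OF S]]) auto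
  have cardN: "card N = card S choose n" unfolding N_def by (rule n_subsets[OF S])
  have "(\<Sum>X\<in>N. card {Y\<in>F. Y \<subseteq> X}) = (\<Sum>Y\<in>F. card {X\<in>N. Y \<subseteq> X})"
    using sum.swap_restrict[OF finN finF, of "\<lambda>_ _. 1::nat" "\<lambda>X Y. Y \<subseteq> X"] by simp
  also have "\<dots> = (\<Sum>Y\<in>F. (card S - card Y) choose (n - card Y))"
    using F by (intro sum.cong refl) (auto simp: N_def conj_assoc intro!: card_supersets_of_card S)
  finally have sum_le: "(\<Sum>X\<in>N. card {Y\<in>F. Y \<subseteq> X}) \<le> (n - k) * card N"
    using le cardN by simp
  have "\<exists>X\<in>N. card {Y\<in>F. Y \<subseteq> X} \<le> n - k"
  proof (rule ccontr)
    assume "\<not> ?thesis"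
    then have "(\<Sum>X\<in>N. Suc (n - k)) \<le> (\<Sum>X\<in>N. card {Y\<in>F. Y \<subseteq> X})"
      by (intro sum_mono) (simp add: not_le Suc_le_eq)
    moreover have "card N > 0" using kn cardN by simp
    ultimately show False using sum_le by (simp add: algebra_simps)
  qed
  then obtain X where X: "X \<subseteq> S" "card X = n" "card {Y\<in>F. Y \<subseteq> X} \<le> n - k" by (auto simp: N_def)
  define f where "f = (\<lambda>Y. SOME y. y \<in> (Y :: 'a set))"
  have f: "f Y \<in> Y" if "Y \<in> F" for Y
    unfolding f_def some_in_eq using F(2)[OF that] by simp
  have "card (f ` {Y\<in>F. Y \<subseteq> X}) \<le> n - k"
    using card_image_le[of "{Y\<in>F. Y \<subseteq> X}" f] finF X(3) by simp
  then have "k \<le> card (X - f ` {Y\<in>F. Y \<subseteq> X})"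
    using diff_card_le_card_Diff[of "f ` {Y\<in>F. Y \<subseteq> X}" X] finF X(2) kn(1) by simp
  then obtain Z where Z: "Z \<subseteq> X - f ` {Y\<in>F. Y \<subseteq> X}" "card Z = k"
    by (rule obtain_subset_with_card_n)
  have "\<not> Y \<subseteq> Z" if "Y \<in> F" for Y
    using f[OF that] that Z(1) by blast
  then show ?thesis using Z X(1) by blast
qed

text \<open>The quotient on the right is the probability that a random \<open>n\<close>-subset of an
  \<open>s\<close>-set contains a given \<open>j\<close>-subset.\<close>

lemma binomial_ratio:
  assumes "j \<le> n" "n \<le> s"
  shows "real ((s - j) choose (n - j)) = real (s choose n) * (real (n choose j) / real (s choose j))"
proof -
  have "real (s choose n) * real (n choose j) = real (s choose j) * real ((s - j) choose (n - j))"
    using choose_mult[OF assms] by (metis of_nat_mult)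
  moreover have "real (s choose j) > 0" using assms by simp
  ultimately show ?thesis by (simp add: field_simps)
qed

section \<open>Averaging over the removed residue classes\<close>

text \<open>A single integer \<open>u\<close> encodes one removed class for every prime up to
  \<open>k\<close>. As \<open>u\<close> runs over a period of the primorial, each choice of classes
  occurs exactly once, so a random \<open>u\<close> is a random sieve.\<close>

definition sieved :: "nat \<Rightarrow> int set \<Rightarrow> int \<Rightarrow> int set" where
  "sieved k I u = {x \<in> I. \<forall>p. prime p \<and> p \<le> k \<longrightarrow> x mod int p \<noteq> u mod int p}"

text \<open>Modulo primes up to \<open>k\<close> the class of \<open>u\<close> is missed by
  construction; a larger prime has more classes than \<open>X\<close> has elements.\<close>

lemma admissible_sieved:
  assumes "X \<subseteq> sieved k I u" "finite X" "card X \<le> k"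
  shows "admissible X"
  unfolding admissible_def
proof (intro allI impI)
  fix p :: nat assume p: "prime p"
  show "\<exists>a. \<forall>x\<in>X. \<not> [x = a] (mod int p)"
  proof (cases "p \<le> k")
    case True
    with assms(1) p show ?thesis by (intro exI[of _ u]) (auto simp: sieved_def cong_def)
  next
    case False
    have "card ((\<lambda>x. x mod int p) ` X) < card {0..<int p}"
      using card_image_le[OF assms(2), of "\<lambda>x. x mod int p"] assms(3) False by simp
    then have "\<not> {0..<int p} \<subseteq> (\<lambda>x. x mod int p) ` X"
      using card_mono[of "(\<lambda>x. x mod int p) ` X" "{0..<int p}"] assms(2) by auto
    then obtain a where "a \<in> {0..<int p}" "a \<notin> (\<lambda>x. x mod int p) ` X" by blast
    then show ?thesis by (intro exI[of _ a]) (auto simp: cong_def)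
  qed
qed

abbreviation residues_of :: "int set \<Rightarrow> nat \<Rightarrow> int set" where
  "residues_of Y p \<equiv> (\<lambda>y. y mod int p) ` Y"

lemma card_sieved:
  assumes "I = {a..<a + int L * int (\<Prod>(primes_upto k))}"
  shows "real (card (sieved k I u)) = real L * (\<Prod>p\<in>primes_upto k. real p - 1)"
proof -
  have "sieved k I u = {x \<in> I. \<forall>p\<in>primes_upto k. x mod int p \<notin> {u mod int p}}"
    by (auto simp: sieved_def)
  also have "real (card \<dots>) = real L * (\<Prod>p\<in>primes_upto k. real p - real (card {u mod int p}))"
    unfolding assms by (rule card_avoiding_residues) (auto simp: finite_primes_le prime_gt_0_nat)
  finally show ?thesis by simp
qed

text \<open>Point and shift exchange roles: \<open>Y\<close> survives the shift \<open>u\<close>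
  exactly when \<open>u\<close> avoids the residues of \<open>Y\<close> modulo every prime up to
  \<open>k\<close>.\<close>

lemma card_shifts_sieving:
  assumes "Y \<subseteq> I"
  shows "real (card {u \<in> {0..<int (\<Prod>(primes_upto k))}. Y \<subseteq> sieved k I u}) =
    (\<Prod>p\<in>primes_upto k. real p - real (card (residues_of Y p)))"
proof -
  have "{u \<in> {0..<int (\<Prod>(primes_upto k))}. Y \<subseteq> sieved k I u} =
    {u \<in> {0..<0 + int 1 * int (\<Prod>(primes_upto k))}. \<forall>p\<in>primes_upto k. u mod int p \<notin> residues_of Y p}"
  proof -
    have "Y \<subseteq> sieved k I u \<longleftrightarrow> (\<forall>p\<in>primes_upto k. u mod int p \<notin> residues_of Y p)" for u
      unfolding sieved_def using assms by (simp add: subset_iff image_iff) metis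
    then show ?thesis by simp
  qed
  also have "real (card \<dots>) = real 1 * (\<Prod>p\<in>primes_upto k. real p - real (card (residues_of Y p)))"
    by (rule card_avoiding_residues) (auto simp: finite_primes_le prime_gt_0_nat)
  finally show ?thesis by simp
qed

text \<open>If no \<open>X\<close> worked, the hypothesis of the deletion lemma would fail in
  \<open>sieved k I u\<close> for every \<open>u\<close>. Summing over one period of
  \<open>u\<close> and exchanging the sums turns survival of \<open>Y\<close> into a count of shifts
  and contradicts \<open>le\<close>. All sieved sets have the same size \<open>s\<close>, so one
  binomial weight serves every shift.\<close>

lemma exists_admissible_avoiding_family:
  assumes I: "I = {a..<a + int L * int (\<Prod>(primes_upto k))}"
    and F: "F \<subseteq> Pow I" "\<And>Y. Y \<in> F \<Longrightarrow> Y \<noteq> {} \<and> card Y \<le> n"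
    and s: "real s = real L * (\<Prod>p\<in>primes_upto k. real p - 1)" and kn: "k \<le> n" "n \<le> s"
    and le: "(\<Sum>Y\<in>F. (\<Prod>p\<in>primes_upto k. real p - real (card (residues_of Y p))) *
      (real (n choose card Y) / real (s choose card Y))) \<le> real (\<Prod>(primes_upto k)) * real (n - k)"
  shows "\<exists>X\<subseteq>I. card X = k \<and> admissible X \<and> (\<forall>Y\<in>F. \<not> Y \<subseteq> X)"
proof (rule ccontr)
  assume none: "\<not> ?thesis"
  define U where "U = {0..<int (\<Prod>(primes_upto k))}"
  define w where "w = (\<lambda>j. (s - j) choose (n - j))"
  have finI: "finite I" by (simp add: I)
  have finF: "finite F" using F(1) finI by (meson finite_Pow_iff finite_subset)
  have Q: "\<Prod>(primes_upto k) > 0" by (intro prod_pos) (auto simp: prime_gt_0_nat)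
  have finS: "finite (sieved k I u)" for u using finI by (simp add: sieved_def)
  have cardS: "card (sieved k I u) = s" for u using card_sieved[OF I, of u] s by simp
  have gt: "(n - k) * (s choose n) < (\<Sum>Y | Y \<in> F \<and> Y \<subseteq> sieved k I u. w (card Y))" for u
  proof (rule ccontr)
    assume "\<not> ?thesis"
    then have "\<exists>X\<subseteq>sieved k I u. card X = k \<and> (\<forall>Y\<in>{Y. Y \<in> F \<and> Y \<subseteq> sieved k I u}. \<not> Y \<subseteq> X)"
      using F kn by (intro exists_subset_avoiding_family[OF finS, where n = n]) (auto simp: cardS w_def not_less)
    then obtain X where X: "X \<subseteq> sieved k I u" "card X = k" "\<forall>Y\<in>{Y. Y \<in> F \<and> Y \<subseteq> sieved k I u}. \<not> Y \<subseteq> X" by blast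
    have "admissible X"
      using X(2) finite_subset[OF X(1) finS] by (intro admissible_sieved[OF X(1)]) auto
    moreover have "X \<subseteq> I" using X(1) by (auto simp: sieved_def)
    moreover have "\<forall>Y\<in>F. \<not> Y \<subseteq> X" using X by blast
    ultimately show False using none X(2) by blast
  qed
  have "(\<Sum>u\<in>U. (n - k) * (s choose n)) < (\<Sum>u\<in>U. \<Sum>Y | Y \<in> F \<and> Y \<subseteq> sieved k I u. w (card Y))"
  proof (rule sum_strict_mono)
    show "U \<noteq> {}" using Q by (simp add: U_def del: of_nat_prod)
  qed (use gt in \<open>auto simp: U_def\<close>)
  also have "\<dots> = (\<Sum>Y\<in>F. \<Sum>u | u \<in> U \<and> Y \<subseteq> sieved k I u. w (card Y))"
    using finF by (intro sum.swap_restrict) (auto simp: U_def)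
  also have "\<dots> = (\<Sum>Y\<in>F. card {u \<in> U. Y \<subseteq> sieved k I u} * w (card Y))"
    by simp
  finally have "real (\<Prod>(primes_upto k) * ((n - k) * (s choose n))) <
      real (\<Sum>Y\<in>F. card {u \<in> U. Y \<subseteq> sieved k I u} * w (card Y))"
    by (simp add: U_def del: of_nat_prod of_nat_mult of_nat_sum)
  also have "\<dots> = (\<Sum>Y\<in>F. (\<Prod>p\<in>primes_upto k. real p - real (card (residues_of Y p))) * real (w (card Y)))"
    using F(1) unfolding U_def of_nat_sum of_nat_mult
    by (intro sum.cong refl arg_cong2[of _ _ _ _ "(*)"] card_shifts_sieving) auto
  also have "\<dots> = (\<Sum>Y\<in>F. (\<Prod>p\<in>primes_upto k. real p - real (card (residues_of Y p))) *
      (real (n choose card Y) / real (s choose card Y))) * real (s choose n)"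
    unfolding sum_distrib_right using F(2) kn
    by (intro sum.cong refl) (simp add: w_def binomial_ratio)
  also have "\<dots> \<le> real (\<Prod>(primes_upto k)) * real (n - k) * real (s choose n)"
    using le by (intro mult_right_mono) auto
  finally show False by (simp add: mult.assoc)
qed

section \<open>Collisions modulo small primes\<close>

text \<open>Replacing the primes by all integers from 2 to \<open>k\<close> makes the product
  telescope. The loss is harmless, since it is later absorbed by the power of 2 in the collision
  estimate.\<close>

lemma euler_product_le_self:
  assumes "k > 0"
  shows "(\<Prod>p\<in>primes_upto k. real p / (real p - 1)) \<le> real k"
proof -
  have "(\<Prod>p\<in>primes_upto k. real p / (real p - 1)) \<le> (\<Prod>j\<in>{2..k}. real j / (real j - 1))"
    by (rule prod_mono2) (auto dest: prime_ge_2_nat simp: field_simps)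
  also have "\<dots> = real k"
    using assms
  proof (induction k rule: nat_induct_non_zero)
    case (Suc k)
    then have "{2..Suc k} = insert (Suc k) {2..k}" by auto
    with Suc show ?case by simp
  qed simp
  finally show ?thesis .
qed

lemma card_residues_of_le:
  assumes "p > 0"
  shows "card (residues_of Y p) \<le> p"
proof -
  have "card (residues_of Y p) \<le> card {0..<int p}"
    using assms by (intro card_mono) auto
  then show ?thesis by simp
qed

definition collisions :: "nat \<Rightarrow> int \<Rightarrow> int \<Rightarrow> nat" where
  "collisions k x y = card {p \<in> primes_upto k. int p dvd x - y}"

lemma collision_iff: "int p dvd x - y \<longleftrightarrow> x mod int p = y mod int p"
  by (simp add: mod_eq_dvd_iff)

text \<open>Each new point contributes a factor \<open>p / (p - 1)\<close> for the primes at which it collides with an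
  earlier point.\<close>

lemma prod_excess_residues_le:
  assumes "finite Y" "Y \<noteq> {}" "card Y \<le> m" "W > 0"
    and "\<And>x y. x \<in> Y \<Longrightarrow> y \<in> Y \<Longrightarrow> x \<noteq> y \<Longrightarrow> collisions k x y \<le> W"
  shows "(\<Prod>p\<in>primes_upto k. (real p / (real p - 1)) ^ (card Y - card (residues_of Y p))) \<le>
    (exp 5 * (1 + ln (real (m * W)))) ^ (card Y - 1)"
  using assms
proof (induction Y rule: finite_ne_induct)
  case (insert x Y)
  let ?f = "\<lambda>p::nat. real p / (real p - 1)"
  let ?D = "{p \<in> primes_upto k. x mod int p \<in> residues_of Y p}"
  have m: "m > 0" using insert by auto
  have f: "0 \<le> ?f p" if "prime p" for p using prime_gt_1_real[OF that] by simp
  \<comment> \<open>The new point raises the excess of points over occupied classes by one exactly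
    at the primes where it falls into an occupied class.\<close>
  have exc: "card (insert x Y) - card (residues_of (insert x Y) p) =
      (card Y - card (residues_of Y p)) + (if p \<in> ?D then 1 else 0)" if "p \<in> primes_upto k" for p
    using insert(1,3) that card_image_le[OF insert(1), of "\<lambda>y. y mod int p"] by (auto simp: insert_absorb card_insert_if)
  \<comment> \<open>Each prime in \<open>?D\<close> comes from a collision of \<open>x\<close> with
    some \<open>y\<close> in \<open>Y\<close>, and each \<open>y\<close> accounts for at most
    \<open>W\<close> primes.\<close>
  have "card ?D \<le> m * W"
  proof -
    have "?D \<subseteq> (\<Union>y\<in>Y. {p \<in> primes_upto k. int p dvd x - y})"
      by (auto simp: collision_iff)
    then have "card ?D \<le> card (\<Union>y\<in>Y. {p \<in> primes_upto k. int p dvd x - y})"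
      using insert(1) finite_primes_le by (intro card_mono) auto
    also have "\<dots> \<le> (\<Sum>y\<in>Y. collisions k x y)"
      unfolding collisions_def by (rule card_UN_le[OF insert(1)])
    also have "\<dots> \<le> (\<Sum>y\<in>Y. W)"
      using insert by (intro sum_mono) (metis insert_iff)
    also have "\<dots> \<le> m * W" using insert by simp
    finally show ?thesis .
  qed
  then have D: "(\<Prod>p\<in>?D. ?f p) \<le> exp 5 * (1 + ln (real (m * W)))"
    using m insert.prems by (intro prod_primes_card_le_ln) (auto simp: finite_primes_le)
  have D0: "0 \<le> (\<Prod>p\<in>?D. ?f p)" using f by (intro prod_nonneg) auto
  have "(\<Prod>p\<in>primes_upto k. ?f p ^ (card (insert x Y) - card (residues_of (insert x Y) p))) =
      (\<Prod>p\<in>primes_upto k. ?f p ^ (card Y - card (residues_of Y p)) * (if p \<in> ?D then ?f p else 1))"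
    by (intro prod.cong refl) (simp add: exc power_add del: card_insert_disjoint image_insert)
  also have "\<dots> = (\<Prod>p\<in>primes_upto k. ?f p ^ (card Y - card (residues_of Y p))) * (\<Prod>p\<in>?D. ?f p)"
  proof -
    have "(\<Prod>p\<in>primes_upto k. if p \<in> ?D then ?f p else 1) = (\<Prod>p\<in>?D. ?f p)"
      by (rule prod.mono_neutral_cong_right) (auto simp: finite_primes_le)
    then show ?thesis by (simp only: prod.distrib)
  qed
  also have "\<dots> \<le> (exp 5 * (1 + ln (real (m * W)))) ^ (card Y - 1) * (exp 5 * (1 + ln (real (m * W))))"
    using D D0 insert by (intro mult_mono insert.IH) (auto intro!: order_trans[OF D0 D] zero_le_power)
  also have "\<dots> = (exp 5 * (1 + ln (real (m * W)))) ^ (card (insert x Y) - 1)"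
  proof -
    have "card Y > 0" using insert(1,2) by auto
    then obtain c where "card Y = Suc c" using gr0_conv_Suc by blast
    then show ?thesis using insert(1,3) by simp
  qed
  finally show ?case .
qed simp

text \<open>Bernoulli's inequality bounds \<open>1 - \<nu> / p\<close> by the
  \<open>\<nu>\<close>-th power of \<open>1 - 1 / p\<close>. Compared with \<open>m\<close>
  independently surviving points, \<open>m - \<nu>\<close> factors are missing at \<open>p\<close>;
  they reappear as powers of \<open>p / (p - 1)\<close>.\<close>

lemma sieve_weight_le:
  assumes "finite Y" "card Y = m"
  shows "(\<Prod>p\<in>primes_upto k. real p - real (card (residues_of Y p))) \<le>
    (\<Prod>p\<in>primes_upto k. real p) * ((\<Prod>p\<in>primes_upto k. real p - 1) / (\<Prod>p\<in>primes_upto k. real p)) ^ m *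
    (\<Prod>p\<in>primes_upto k. (real p / (real p - 1)) ^ (m - card (residues_of Y p)))"
proof -
  have "(\<Prod>p\<in>primes_upto k. real p - real (card (residues_of Y p))) \<le>
    (\<Prod>p\<in>primes_upto k. real p * ((real p - 1) / real p) ^ m * (real p / (real p - 1)) ^ (m - card (residues_of Y p)))"
  proof (rule prod_mono, rule conjI)
    fix p assume p: "p \<in> primes_upto k"
    let ?\<nu> = "card (residues_of Y p)"
    have p1: "real p > 1" using p prime_gt_1_real by blast
    show "0 \<le> real p - real ?\<nu>" using card_residues_of_le[of p Y] p1 by auto
    have \<nu>: "?\<nu> \<le> m" using card_image_le[OF assms(1)] assms(2) by simp
    have "1 - real ?\<nu> / real p \<le> (1 - 1 / real p) ^ ?\<nu>"
      using Bernoulli_inequality[of "- 1 / real p" ?\<nu>] p1 by simp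
    then have "real p - real ?\<nu> \<le> real p * ((real p - 1) / real p) ^ ?\<nu>"
      using p1 mult_left_mono[of "1 - real ?\<nu> / real p" "(1 - 1 / real p) ^ ?\<nu>" "real p"]
      by (simp add: right_diff_distrib diff_divide_distrib)
    also have "((real p - 1) / real p) ^ ?\<nu> = ((real p - 1) / real p) ^ m * (real p / (real p - 1)) ^ (m - ?\<nu>)"
    proof -
      have "((real p - 1) / real p) ^ m = ((real p - 1) / real p) ^ ?\<nu> * ((real p - 1) / real p) ^ (m - ?\<nu>)"
        using \<nu> by (simp flip: power_add)
      moreover have "((real p - 1) / real p) ^ (m - ?\<nu>) * (real p / (real p - 1)) ^ (m - ?\<nu>) = 1"
        using p1 by (simp flip: power_mult_distrib)
      ultimately show ?thesis by (simp add: mult.assoc)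
    qed
    finally show "real p - real ?\<nu> \<le> real p * ((real p - 1) / real p) ^ m * (real p / (real p - 1)) ^ (m - ?\<nu>)"
      by (simp add: mult.assoc)
  qed
  also have "\<dots> = (\<Prod>p\<in>primes_upto k. real p) * ((\<Prod>p\<in>primes_upto k. real p - 1) / (\<Prod>p\<in>primes_upto k. real p)) ^ m *
    (\<Prod>p\<in>primes_upto k. (real p / (real p - 1)) ^ (m - card (residues_of Y p)))"
    by (simp only: prod.distrib prod_dividef flip: prod_power_distrib)
  finally show ?thesis .
qed

text \<open>An exponential moment of the number of collisions. At each prime the class of
  \<open>x\<close> gives \<open>2 * (p - 1)\<close> and the others give
  \<open>(p - 1) * (p - 2)\<close>, in total \<open>p * (p - 1)\<close>; unweighted it would be the
  square of \<open>p - 1\<close>. So the weight costs only the Euler product.\<close>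

lemma sum_collision_weights:
  assumes I: "I = {a..<a + int L * int (\<Prod>(primes_upto k))}"
  shows "(\<Sum>y\<in>I. 2 ^ collisions k x y * (\<Prod>p\<in>primes_upto k. real p - real (card (residues_of {x, y} p)))) =
    real L * (\<Prod>p\<in>primes_upto k. real p) * (\<Prod>p\<in>primes_upto k. real p - 1)"
proof -
  let ?F = "\<lambda>p c. if c = x mod int p then 2 * (real p - 1) else real p - 2"
  have "2 ^ collisions k x y * (\<Prod>p\<in>primes_upto k. real p - real (card (residues_of {x, y} p))) =
      (\<Prod>p\<in>primes_upto k. ?F p (y mod int p))" for y
  proof -
    have "(2::real) ^ collisions k x y = (\<Prod>p | p \<in> primes_upto k \<and> int p dvd x - y. 2)"
      by (simp add: collisions_def)
    also have "\<dots> = (\<Prod>p\<in>primes_upto k. if int p dvd x - y then 2 else 1)"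
      by (rule prod.inter_filter[OF finite_primes_le])
    finally have "2 ^ collisions k x y * (\<Prod>p\<in>primes_upto k. real p - real (card (residues_of {x, y} p))) =
      (\<Prod>p\<in>primes_upto k. (if int p dvd x - y then 2 else 1) * (real p - real (card (residues_of {x, y} p))))"
      by (simp only: prod.distrib)
    also have "\<dots> = (\<Prod>p\<in>primes_upto k. ?F p (y mod int p))"
      by (intro prod.cong refl) (auto simp: collision_iff card_insert_if)
    finally show ?thesis .
  qed
  then have "(\<Sum>y\<in>I. 2 ^ collisions k x y * (\<Prod>p\<in>primes_upto k. real p - real (card (residues_of {x, y} p)))) =
      (\<Sum>y\<in>I. \<Prod>p\<in>primes_upto k. ?F p (y mod int p))" by simp
  also have "\<dots> = real L * (\<Prod>p\<in>primes_upto k. \<Sum>c\<in>{0..<int p}. ?F p c)"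
    unfolding I by (rule sum_prod_residues) (auto simp: finite_primes_le)
  also have "(\<Prod>p\<in>primes_upto k. \<Sum>c\<in>{0..<int p}. ?F p c) = (\<Prod>p\<in>primes_upto k. real p * (real p - 1))"
  proof (intro prod.cong refl)
    fix p assume p: "p \<in> primes_upto k"
    then have "p > 0" by (auto simp: prime_gt_0_nat)
    then have x: "x mod int p \<in> {0..<int p}" by simp
    have "(\<Sum>c\<in>{0..<int p}. ?F p c) = ?F p (x mod int p) + (\<Sum>c\<in>{0..<int p} - {x mod int p}. ?F p c)"
      using x by (intro sum.remove) auto
    also have "(\<Sum>c\<in>{0..<int p} - {x mod int p}. ?F p c) = (\<Sum>c\<in>{0..<int p} - {x mod int p}. real p - 2)"
      by (intro sum.cong) auto
    also have "\<dots> = (real p - 1) * (real p - 2)"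
      using x \<open>p > 0\<close> by (simp add: of_nat_diff)
    finally show "(\<Sum>c\<in>{0..<int p}. ?F p c) = real p * (real p - 1)" by (simp add: algebra_simps)
  qed
  finally show ?thesis by (simp add: prod.distrib mult.assoc)
qed

text \<open>Markov's inequality for the exponential moment: beyond \<open>W\<close> collisions the
  weight exceeds \<open>2 ^ W\<close>. Passing from unordered to ordered pairs only enlarges the
  sum, as the terms are nonnegative.\<close>

lemma sum_colliding_pairs_le:
  fixes L k W :: nat and a :: int
  defines "I \<equiv> {a..<a + int L * int (\<Prod>(primes_upto k))}"
  defines "Q \<equiv> \<Prod>p\<in>primes_upto k. real p" and "\<phi> \<equiv> \<Prod>p\<in>primes_upto k. real p - 1"
  shows "(\<Sum>Y\<in>(\<lambda>(x, y). {x, y}) ` {(x, y) \<in> I \<times> I. x \<noteq> y \<and> W < collisions k x y}.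
      \<Prod>p\<in>primes_upto k. real p - real (card (residues_of Y p))) \<le> (real L * Q)\<^sup>2 * \<phi> / 2 ^ W"
proof -
  let ?T = "{(x, y) \<in> I \<times> I. x \<noteq> y \<and> W < collisions k x y}"
  let ?V = "\<lambda>Y. \<Prod>p\<in>primes_upto k. real p - real (card (residues_of Y p))"
  have V: "?V Y \<ge> 0" for Y
    using card_residues_of_le prime_gt_0_nat by (intro prod_nonneg) force
  have finI: "finite I" by (simp add: I_def)
  then have finT: "finite ?T" by (intro finite_subset[of ?T "I \<times> I"]) auto
  have "(\<Sum>Y\<in>(\<lambda>(x, y). {x, y}) ` ?T. ?V Y) \<le> (\<Sum>z\<in>?T. ?V (case z of (x, y) \<Rightarrow> {x, y}))"
    using sum_image_le[OF finT, of ?V "\<lambda>(x, y). {x, y}"] V by (simp add: o_def)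
  also have "\<dots> \<le> (\<Sum>(x, y)\<in>?T. 2 ^ collisions k x y * ?V {x, y} / 2 ^ W)"
  proof (rule sum_mono, clarify)
    fix x y assume "W < collisions k x y"
    then have "(2::real) ^ W \<le> 2 ^ collisions k x y" by (intro power_increasing) auto
    then show "?V {x, y} \<le> 2 ^ collisions k x y * ?V {x, y} / 2 ^ W"
      using mult_right_mono[of "2 ^ W" "2 ^ collisions k x y" "?V {x, y}"] V[of "{x, y}"]
      by (simp add: pos_le_divide_eq mult.commute)
  qed
  also have "\<dots> \<le> (\<Sum>(x, y)\<in>I \<times> I. 2 ^ collisions k x y * ?V {x, y} / 2 ^ W)"
  proof (rule sum_mono2, goal_cases)
    case (3 z)
    obtain x y where "z = (x, y)" by fastforce
    then show ?case using V[of "{x, y}"] by (simp only: prod.case) (intro divide_nonneg_nonneg mult_nonneg_nonneg, auto)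
  qed (use finI in auto)
  also have "\<dots> = (\<Sum>x\<in>I. \<Sum>y\<in>I. 2 ^ collisions k x y * ?V {x, y}) / 2 ^ W"
    by (simp add: sum.cartesian_product sum_divide_distrib split_def)
  also have "\<dots> = (\<Sum>x\<in>I. real L * Q * \<phi>) / 2 ^ W"
    unfolding Q_def \<phi>_def by (subst sum_collision_weights[OF I_def[THEN meta_eq_to_obj_eq]]) simp
  also have "\<dots> = (real L * Q)\<^sup>2 * \<phi> / 2 ^ W"
    by (simp add: I_def Q_def power2_eq_square nat_mult_distrib prod_nonneg)
  finally show ?thesis .
qed

text \<open>The \<open>fact m\<close> reorderings of an injective tuple are distinct, stay in
  \<open>A\<close> and share its range, and tuples with different ranges differ. The gain of
  \<open>fact m\<close> is what produces \<open>k / m\<close> rather than \<open>k\<close> in the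
  final bound.\<close>

lemma card_permutation_classes:
  assumes sub: "A \<subseteq> {1..m} \<rightarrow>\<^sub>E UNIV" and perm: "\<forall>h\<in>A. \<forall>\<sigma>. \<sigma> permutes {1..m} \<longrightarrow> h \<circ> \<sigma> \<in> A"
    and I: "finite I" and F: "\<And>Y. Y \<in> F \<Longrightarrow> Y \<subseteq> I \<and> (\<exists>h\<in>A. inj_on h {1..m} \<and> h ` {1..m} = Y)"
  shows "fact m * card F \<le> card (A \<inter> ({1..m} \<rightarrow>\<^sub>E I))"
proof -
  let ?B = "A \<inter> ({1..m} \<rightarrow>\<^sub>E I)"
  have finB: "finite ?B" using I by (auto intro: finite_PiE)
  have finF: "finite F" using F I by (intro finite_subset[of F "Pow I"]) auto
  have fib: "fact m \<le> card {h \<in> ?B. h ` {1..m} = Y}" if Y: "Y \<in> F" for Y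
  proof -
    obtain h where h: "h \<in> A" "inj_on h {1..m}" "h ` {1..m} = Y" and YI: "Y \<subseteq> I" using F[OF Y] by auto
    have "inj_on (\<lambda>\<sigma>. h \<circ> \<sigma>) {\<sigma>. \<sigma> permutes {1..m}}"
    proof (rule inj_onI, safe)
      fix \<sigma> \<tau> assume st: "\<sigma> permutes {1..m}" "\<tau> permutes {1..m}" "h \<circ> \<sigma> = h \<circ> \<tau>"
      show "\<sigma> = \<tau>"
      proof
        fix i
        show "\<sigma> i = \<tau> i"
        proof (cases "i \<in> {1..m}")
          case True
          have "h (\<sigma> i) = h (\<tau> i)" using fun_cong[OF st(3)] by simp
          with True h(2) st(1,2) show ?thesis by (meson inj_onD permutes_in_image)
        qed (use st in \<open>simp add: permutes_not_in\<close>)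
      qed
    qed
    moreover have "(\<lambda>\<sigma>. h \<circ> \<sigma>) ` {\<sigma>. \<sigma> permutes {1..m}} \<subseteq> {h \<in> ?B. h ` {1..m} = Y}"
    proof (rule image_subsetI, clarify)
      fix \<sigma> assume \<sigma>: "\<sigma> permutes {1..m}"
      then have hA: "h \<circ> \<sigma> \<in> A" using perm h(1) by blast
      have im: "(h \<circ> \<sigma>) ` {1..m} = Y" using h(3) permutes_image[OF \<sigma>] by (metis image_comp)
      then have "h \<circ> \<sigma> \<in> {1..m} \<rightarrow>\<^sub>E I" using YI hA sub by (auto simp: PiE_def)
      with hA im show "h \<circ> \<sigma> \<in> ?B \<and> (h \<circ> \<sigma>) ` {1..m} = Y" by blast
    qed
    ultimately have "card {\<sigma>. \<sigma> permutes {1..m}} \<le> card {h \<in> ?B. h ` {1..m} = Y}"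
      by (rule card_inj_on_le) (rule finite_subset[OF _ finB], blast)
    then show ?thesis using card_permutations[of "{1..m}" m] by simp
  qed
  have "fact m * card F = (\<Sum>Y\<in>F. fact m)" by simp
  also have "\<dots> \<le> (\<Sum>Y\<in>F. card {h \<in> ?B. h ` {1..m} = Y})" by (intro sum_mono fib)
  also have "\<dots> = card (\<Union>Y\<in>F. {h \<in> ?B. h ` {1..m} = Y})"
  proof (rule card_UN_disjoint[symmetric])
    show "\<forall>Y\<in>F. finite {h \<in> ?B. h ` {1..m} = Y}"
      by (intro ballI finite_subset[OF _ finB]) blast
  qed (use finF in auto)
  also have "\<dots> \<le> card ?B" using finB by (intro card_mono) auto
  finally show ?thesis .
qed

text \<open>One term of the exponential series; this is all of Stirling's formula that the estimates
  use.\<close>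

lemma power_le_exp_fact: "real m ^ m \<le> exp (real m) * fact m"
proof -
  have "real m ^ m / fact m = (\<Sum>n\<in>{m}. real m ^ n / fact n)" by simp
  also have "\<dots> \<le> (\<Sum>n. real m ^ n / fact n)"
    using summable_exp_generic[of "real m"]
    by (intro sum_le_suminf) (auto simp: divide_inverse mult.commute)
  also have "\<dots> = exp (real m)" by (simp add: exp_def divide_inverse mult.commute)
  finally show ?thesis by (simp add: field_simps)
qed

lemma binomial_le_exp_power:
  assumes "m > 0"
  shows "real (n choose m) \<le> (exp 1 * real n / real m) ^ m"
proof -
  have "real (n choose m) * fact m \<le> real n ^ m"
    using binomial_fact_pow[of n m] by (metis of_nat_fact of_nat_le_iff of_nat_mult of_nat_power)
  moreover have "real (n choose m) * real m ^ m \<le> real (n choose m) * (exp (real m) * fact m)"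
    by (intro mult_left_mono power_le_exp_fact) auto
  ultimately have "real (n choose m) * real m ^ m \<le> exp (real m) * real n ^ m"
    by (smt (verit) exp_gt_zero mult.left_commute mult_left_mono)
  moreover have "exp (real m) = exp 1 ^ m" by (simp add: exp_of_nat_mult[symmetric])
  ultimately show ?thesis using assms by (simp add: power_divide power_mult_distrib field_simps)
qed

section \<open>Lower bound for the density of plausible sets\<close>

text \<open>If the count were smaller, the deletion method with \<open>n = 2 * k\<close> would apply
  to the family of bad pairs \<open>T\<close> together with the family \<open>F\<close> of ranges of
  injective tuples of \<open>A\<close> free of such pairs. The resulting admissible
  \<open>k\<close>-set contains a tuple of \<open>A\<close> by plausibility, whose range must lie in
  \<open>F\<close> because no pair of \<open>T\<close> is left: a contradiction.\<close>

lemma plausible_count_lower: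
  fixes k m L W :: nat and a :: int
  assumes A: "plausible m k A" and mk: "1 \<le> m" "m \<le> k" and L: "2 * k \<le> L" and W: "16 * k\<^sup>2 \<le> 2 ^ W"
  defines "Q \<equiv> \<Prod>p\<in>primes_upto k. real p"
  defines "I \<equiv> {a..<a + int L * int (\<Prod>(primes_upto k))}"
  defines "G \<equiv> exp 5 * (1 + ln (real (m * W)))"
  shows "real k / 2 < real (card (A \<inter> ({1..m} \<rightarrow>\<^sub>E I))) * (2 * (exp 1)\<^sup>2 * real k / (real m * (real L * Q))) ^ m * G ^ (m - 1)"
proof (rule ccontr)
  assume neg: "\<not> ?thesis"
  define \<phi> where "\<phi> = (\<Prod>p\<in>primes_upto k. real p - 1)"
  define s where "s = L * (\<Prod>p\<in>primes_upto k. p - 1)"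
  define V where "V = (\<lambda>Y. \<Prod>p\<in>primes_upto k. real p - real (card (residues_of Y p)))"
  define N where "N = real (card (A \<inter> ({1..m} \<rightarrow>\<^sub>E I)))"
  define T where "T = (\<lambda>(x, y). {x, y}) ` {(x, y) \<in> I \<times> I. x \<noteq> y \<and> W < collisions k x y}"
  define F where "F = {Y. Y \<subseteq> I \<and> (\<exists>h\<in>A. inj_on h {1..m} \<and> h ` {1..m} = Y) \<and>
    (\<forall>x\<in>Y. \<forall>y\<in>Y. x \<noteq> y \<longrightarrow> collisions k x y \<le> W)}"
  have "k\<^sup>2 > 0" using mk by simp
  with W have "W > 0" by (cases "W = 0") auto
  have prod_nat: "(\<Prod>p\<in>primes_upto k. real (p - 1)) = \<phi>"
    unfolding \<phi>_def by (intro prod.cong refl) (simp add: of_nat_diff prime_ge_Suc_0_nat)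
  have s: "real s = real L * \<phi>" unfolding s_def of_nat_mult of_nat_prod prod_nat ..
  have Q: "Q > 0" unfolding Q_def by (intro prod_pos) (auto simp: prime_gt_0_nat)
  have \<phi>: "\<phi> > 0" unfolding \<phi>_def by (intro prod_pos) (auto dest: prime_gt_1_real)
  \<comment> \<open>Every prime leaves at least one class, so \<open>L\<close> periods keep at least
    \<open>L\<close> points: enough to draw \<open>2 * k\<close> of them.\<close>
  have "(\<Prod>p\<in>primes_upto k. p - 1) \<ge> 1"
    by (intro prod_ge_1) (auto dest: prime_ge_2_nat)
  then have "L \<le> s" unfolding s_def by simp
  with L have ks: "2 * k \<le> s" by simp
  then have s0: "real s > 0" using mk by simp
  have L0: "real L > 0" using L mk by simp
  have Q\<phi>: "Q / \<phi> \<le> real k"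
    using euler_product_le_self[of k] mk by (simp add: Q_def \<phi>_def prod_dividef)
  have finI: "finite I" by (simp add: I_def)
  have V0: "V Y \<ge> 0" for Y
    unfolding V_def using card_residues_of_le prime_gt_0_nat by (intro prod_nonneg) force
  have "T \<subseteq> Pow I" by (auto simp: T_def)
  have "F \<subseteq> Pow I" by (auto simp: F_def)
  have finT: "finite T" and finF: "finite F"
    using \<open>T \<subseteq> Pow I\<close> \<open>F \<subseteq> Pow I\<close> finI by (meson finite_Pow_iff finite_subset)+
  have card_T: "card Y = 2" if "Y \<in> T" for Y using that by (auto simp: T_def)
  have card_F: "card Y = m" if "Y \<in> F" for Y using that card_image by (fastforce simp: F_def)
  have ge: "(real s / real j) ^ j \<le> real (s choose j)" if "j \<le> s" for j
    using binomial_ge_n_over_k_pow_k[OF that, where ?'a = real] .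

  have "(\<Sum>Y\<in>T. V Y * (real (2 * k choose card Y) / real (s choose card Y))) =
      (\<Sum>Y\<in>T. V Y) * (real (2 * k choose 2) / real (s choose 2))"
    unfolding sum_distrib_right by (intro sum.cong) (auto simp: card_T)
  also have "\<dots> \<le> ((real L * Q)\<^sup>2 * \<phi> / 2 ^ W) * (2 * (real k)\<^sup>2 / (real s / 2)\<^sup>2)"
  proof (intro mult_mono frac_le)
    show "(\<Sum>Y\<in>T. V Y) \<le> (real L * Q)\<^sup>2 * \<phi> / 2 ^ W"
      unfolding T_def V_def Q_def \<phi>_def I_def by (rule sum_colliding_pairs_le)
    have "real (2 * k choose 2) * fact 2 \<le> real (2 * k) ^ 2"
      using binomial_fact_pow[of "2 * k" 2] by (metis of_nat_fact of_nat_le_iff of_nat_mult of_nat_power)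
    then show "real (2 * k choose 2) \<le> 2 * (real k)\<^sup>2" by (simp add: power2_eq_square)
    show "(real s / 2)\<^sup>2 \<le> real (s choose 2)" using ge[of 2] ks mk by simp
  qed (use s0 \<phi> in auto)
  also have "\<dots> = Q * (Q / \<phi>) * (8 * (real k)\<^sup>2 / 2 ^ W)"
    using \<phi> L0 unfolding s by (simp add: field_simps power2_eq_square)
  \<comment> \<open>Here the size of \<open>W\<close> enters: \<open>2 ^ W\<close> pays for the
    squared number of points, while the Euler product left over from the exponential moment costs
    one factor \<open>k\<close>.\<close>
  also have "\<dots> \<le> Q * real k * (1 / 2)"
  proof (intro mult_mono Q\<phi> order_refl)
    have "real (16 * k\<^sup>2) \<le> real (2 ^ W)" using W by (simp only: of_nat_le_iff)
    then have "16 * (real k)\<^sup>2 \<le> 2 ^ W" by simp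
    then show "8 * (real k)\<^sup>2 / 2 ^ W \<le> 1 / 2" by (simp add: field_simps)
  qed (use Q \<phi> in auto)
  finally have sumT: "(\<Sum>Y\<in>T. V Y * (real (2 * k choose card Y) / real (s choose card Y))) \<le> Q * real k / 2" by simp

  have VF: "V Y \<le> Q * (\<phi> / Q) ^ m * G ^ (m - 1)" if Y: "Y \<in> F" for Y
  proof -
    have fin: "finite Y" using Y finI finite_subset by (auto simp: F_def)
    have "Y \<noteq> {}" using card_F[OF Y] mk by auto
    have "V Y \<le> Q * (\<phi> / Q) ^ m * (\<Prod>p\<in>primes_upto k. (real p / (real p - 1)) ^ (card Y - card (residues_of Y p)))"
      using sieve_weight_le[OF fin card_F[OF Y], of k] card_F[OF Y] by (simp add: V_def Q_def \<phi>_def)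
    also have "\<dots> \<le> Q * (\<phi> / Q) ^ m * (exp 5 * (1 + ln (real (m * W)))) ^ (card Y - 1)"
      using Y Q \<phi> \<open>W > 0\<close> \<open>Y \<noteq> {}\<close> card_F[OF Y] fin
      by (intro mult_left_mono prod_excess_residues_le) (auto simp: F_def)
    finally show ?thesis by (simp add: G_def card_F[OF Y])
  qed
  have "fact m * card F \<le> card (A \<inter> ({1..m} \<rightarrow>\<^sub>E I))"
    using A by (intro card_permutation_classes finI) (auto simp: plausible_def F_def)
  then have "fact m * real (card F) \<le> N"
    unfolding N_def by (metis of_nat_fact of_nat_le_iff of_nat_mult)
  then have "exp (real m) * (fact m * real (card F)) \<le> exp (real m) * N" by simp
  moreover have "real m ^ m * real (card F) \<le> exp (real m) * (fact m * real (card F))"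
    using mult_right_mono[OF power_le_exp_fact, of "real (card F)" m] by (simp add: mult.assoc)
  ultimately have "real m ^ m * real (card F) \<le> exp (real m) * N" by linarith
  moreover have "exp (real m) = exp 1 ^ m" by (simp add: exp_of_nat_mult[symmetric])
  ultimately have cardF: "real (card F) \<le> N * (exp 1 / real m) ^ m"
    using mk by (simp add: power_divide field_simps)
  have G0: "G \<ge> 0"
  proof -
    have "real (m * W) \<ge> 1" using mk \<open>W > 0\<close> by (simp del: of_nat_mult add: Suc_leI)
    then show ?thesis by (simp add: G_def)
  qed
  have "(\<Sum>Y\<in>F. V Y * (real (2 * k choose card Y) / real (s choose card Y))) =
      (\<Sum>Y\<in>F. V Y) * (real (2 * k choose m) / real (s choose m))"
    unfolding sum_distrib_right by (intro sum.cong) (auto simp: card_F)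
  also have "\<dots> \<le> (N * (exp 1 / real m) ^ m * (Q * (\<phi> / Q) ^ m * G ^ (m - 1))) *
      ((exp 1 * real (2 * k) / real m) ^ m / (real s / real m) ^ m)"
  proof (intro mult_mono frac_le)
    have "(\<Sum>Y\<in>F. V Y) \<le> real (card F) * (Q * (\<phi> / Q) ^ m * G ^ (m - 1))"
      using VF by (rule sum_bounded_above)
    also have "\<dots> \<le> N * (exp 1 / real m) ^ m * (Q * (\<phi> / Q) ^ m * G ^ (m - 1))"
      using cardF Q \<phi> G0 by (intro mult_right_mono) auto
    finally show "(\<Sum>Y\<in>F. V Y) \<le> N * (exp 1 / real m) ^ m * (Q * (\<phi> / Q) ^ m * G ^ (m - 1))" .
    show "real (2 * k choose m) \<le> (exp 1 * real (2 * k) / real m) ^ m"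
      using mk by (intro binomial_le_exp_power) auto
    show "(real s / real m) ^ m \<le> real (s choose m)" using ge[of m] ks mk by simp
  qed (use s0 mk Q \<phi> G0 in \<open>auto simp: N_def\<close>)
  also have "\<dots> = Q * (N * (exp 1 / real m * (\<phi> / Q) * (exp 1 * real (2 * k) / real m) / (real s / real m)) ^ m * G ^ (m - 1))"
  proof -
    have "N * u ^ m * (Q * v ^ m * g) * (w ^ m / z ^ m) = Q * (N * (u * v * w / z) ^ m * g)" for u v w z g :: real
      by (simp only: power_mult_distrib power_divide) (simp add: mult_ac)
    then show ?thesis .
  qed
  \<comment> \<open>The sieve density cancels: each point survives with probability
    \<open>\<phi> / Q\<close>, but the sample is drawn from only \<open>s = L * \<phi>\<close>
    survivors.\<close>
  also have "exp 1 / real m * (\<phi> / Q) * (exp 1 * real (2 * k) / real m) / (real s / real m) =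
      2 * (exp 1)\<^sup>2 * real k / (real m * (real L * Q))"
    using L0 \<phi> mk unfolding s by (simp add: field_simps power2_eq_square)
  also have "Q * (N * (2 * (exp 1)\<^sup>2 * real k / (real m * (real L * Q))) ^ m * G ^ (m - 1)) \<le> Q * (real k / 2)"
    using neg Q by (intro mult_left_mono) (auto simp: N_def not_less)
  finally have sumF: "(\<Sum>Y\<in>F. V Y * (real (2 * k choose card Y) / real (s choose card Y))) \<le> Q * real k / 2"
    by simp

  \<comment> \<open>\<open>F\<close> and \<open>T\<close> each use half of the budget
    \<open>Q * (2 * k - k)\<close>.\<close>
  have "\<exists>X\<subseteq>I. card X = k \<and> admissible X \<and> (\<forall>Y\<in>F \<union> T. \<not> Y \<subseteq> X)"
  proof (rule exists_admissible_avoiding_family[OF I_def[THEN meta_eq_to_obj_eq]])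
    show "F \<union> T \<subseteq> Pow I" using \<open>T \<subseteq> Pow I\<close> \<open>F \<subseteq> Pow I\<close> by blast
    show "Y \<noteq> {} \<and> card Y \<le> 2 * k" if "Y \<in> F \<union> T" for Y
      using that card_F[of Y] card_T[of Y] mk by auto
    show "real s = real L * (\<Prod>p\<in>primes_upto k. real p - 1)" using s by (simp add: \<phi>_def)
    show "k \<le> 2 * k" "2 * k \<le> s" using ks by auto
    let ?f = "\<lambda>Y. V Y * (real (2 * k choose card Y) / real (s choose card Y))"
    have "(\<Sum>Y\<in>F \<union> T. ?f Y) \<le> (\<Sum>Y\<in>F. ?f Y) + (\<Sum>Y\<in>T. ?f Y)"
      using sum.union_inter[OF finF finT, of ?f] sum_nonneg[of "F \<inter> T" ?f] V0 by (simp add: mult_nonneg_nonneg)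
    also have "\<dots> \<le> Q * real k" using sumF sumT by simp
    finally show "(\<Sum>Y\<in>F \<union> T. (\<Prod>p\<in>primes_upto k. real p - real (card (residues_of Y p))) *
        (real (2 * k choose card Y) / real (s choose card Y))) \<le> real (\<Prod>(primes_upto k)) * real (2 * k - k)"
      by (simp add: V_def Q_def)
  qed
  then obtain X where X: "X \<subseteq> I" "card X = k" "admissible X" and avoid: "\<And>Y. Y \<in> F \<union> T \<Longrightarrow> \<not> Y \<subseteq> X" by blast
  obtain h where h: "h \<in> A" "inj_on h {1..m}" "h ` {1..m} \<subseteq> X"
  proof -
    have "\<forall>X. finite X \<and> card X = k \<and> admissible X \<longrightarrow> (\<exists>h\<in>A. inj_on h {1..m} \<and> h ` {1..m} \<subseteq> X)"
      using A by (simp add: plausible_def)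
    then show ?thesis using X finite_subset[OF X(1) finI] that by blast
  qed
  have "collisions k x y \<le> W" if "x \<in> X" "y \<in> X" "x \<noteq> y" for x y
  proof (rule ccontr)
    assume "\<not> ?thesis"
    then have "{x, y} \<in> T" using that X(1) unfolding T_def by (intro image_eqI[of _ _ "(x, y)"]) auto
    then show False using avoid that by blast
  qed
  then have "h ` {1..m} \<in> F" using h X(1) unfolding F_def by blast
  then show False using avoid h(3) by blast
qed

text \<open>A long initial stretch of the box side consists of whole periods, where the counting
  bound applies. Its length is at least \<open>N\<close>, half of \<open>2 * N\<close>; this doubles
  the constant from \<open>2\<close> to \<open>4\<close>.\<close>

lemma lower_density_plausible_ge:
  fixes k m W :: nat
  assumes A: "plausible m k A" and mk: "1 \<le> m" "m \<le> k" and W: "16 * k\<^sup>2 \<le> 2 ^ W"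
  defines "G \<equiv> exp 5 * (1 + ln (real (m * W)))"
  shows "ereal (real k / 2 / ((4 * (exp 1)\<^sup>2 * real k / real m) ^ m * G ^ (m - 1))) \<le> lower_density m A"
  unfolding lower_density_def
proof (rule Liminf_bounded, rule eventually_sequentiallyI)
  define Q where "Q = \<Prod>(primes_upto k)"
  have "k\<^sup>2 > 0" using mk by simp
  with W have "W > 0" by (cases "W = 0") auto
  have Q: "Q > 0" unfolding Q_def by (intro prod_pos) (auto simp: prime_gt_0_nat)
  \<comment> \<open>Only large \<open>N\<close> matter for the liminf. The threshold yields at least
    \<open>2 * k\<close> periods and also \<open>Q \<le> N\<close>, so the incomplete last period
    costs at most \<open>N\<close>.\<close>
  fix N assume N: "2 * k * Q \<le> N"
  define L where "L = 2 * N div Q"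
  define I where "I = {- int N..<- int N + int L * int Q}"
  let ?c = "real (card (A \<inter> ({1..m} \<rightarrow>\<^sub>E {- int N..int N})))"
  have "0 < N" using N Q mk by (cases "N = 0") auto
  have "2 * k \<le> L" using N Q unfolding L_def by (simp add: less_eq_div_iff_mult_less_eq)
  have LQ: "L * Q \<le> 2 * N" "2 * N < L * Q + Q"
    using div_mult_mod_eq[of "2 * N" Q] mod_less_divisor[OF Q, of "2 * N"] unfolding L_def by linarith+
  have "1 * Q \<le> 2 * k * Q" using mk by (intro mult_right_mono) auto
  then have "Q \<le> N" using N by linarith
  then have "N \<le> L * Q" using LQ by linarith
  then have NLQ: "real N \<le> real L * real Q" by (metis of_nat_le_iff of_nat_mult)
  have "int L * int Q \<le> 2 * int N" using LQ(1) by (metis of_nat_le_iff of_nat_mult of_nat_numeral)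
  then have "I \<subseteq> {- int N..int N}" by (auto simp: I_def)
  then have "A \<inter> ({1..m} \<rightarrow>\<^sub>E I) \<subseteq> A \<inter> ({1..m} \<rightarrow>\<^sub>E {- int N..int N})" by (intro Int_mono PiE_mono) auto
  then have card_le: "real (card (A \<inter> ({1..m} \<rightarrow>\<^sub>E I))) \<le> ?c"
    by (intro of_nat_mono card_mono finite_Int disjI2 finite_PiE) auto
  have G: "G > 0"
  proof -
    have "real (m * W) \<ge> 1" using mk \<open>W > 0\<close> by (simp del: of_nat_mult add: Suc_leI)
    then have "ln (real (m * W)) \<ge> 0" by (simp only: ln_ge_zero)
    then show ?thesis unfolding G_def by simp
  qed
  have "real k / 2 < real (card (A \<inter> ({1..m} \<rightarrow>\<^sub>E I))) * (2 * (exp 1)\<^sup>2 * real k / (real m * (real L * real Q))) ^ m * G ^ (m - 1)"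
    using plausible_count_lower[OF A mk \<open>2 * k \<le> L\<close> W, of "- int N"]
    unfolding Q_def I_def G_def of_nat_prod .
  also have "\<dots> \<le> ?c * (2 * (exp 1)\<^sup>2 * real k / (real m * real N)) ^ m * G ^ (m - 1)"
    using card_le NLQ G mk \<open>0 < N\<close> \<open>2 * k \<le> L\<close> Q
    by (intro mult_right_mono mult_mono power_mono divide_left_mono mult_left_mono mult_pos_pos) auto
  also have "2 * (exp 1)\<^sup>2 * real k / (real m * real N) = (4 * (exp 1)\<^sup>2 * real k / real m) / (2 * real N)"
    using mk \<open>0 < N\<close> by (simp add: field_simps)
  also have "?c * \<dots> ^ m * G ^ (m - 1) = (?c / (2 * real N) ^ m) * ((4 * (exp 1)\<^sup>2 * real k / real m) ^ m * G ^ (m - 1))"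
    by (simp only: power_divide) (simp add: mult_ac)
  finally have "real k / 2 / ((4 * (exp 1)\<^sup>2 * real k / real m) ^ m * G ^ (m - 1)) \<le> ?c / (2 * real N) ^ m"
    using G mk by (subst pos_divide_le_eq) (auto intro!: mult_pos_pos)
  then show "ereal (real k / 2 / ((4 * (exp 1)\<^sup>2 * real k / real m) ^ m * G ^ (m - 1))) \<le>
      ereal (?c / (2 * real N) ^ m)" by simp
qed

section \<open>Choosing the threshold and simplifying the logarithms\<close>

lemma exists_collision_threshold:
  assumes "k > 0"
  shows "\<exists>W::nat. 16 * k\<^sup>2 \<le> 2 ^ W \<and> W > 0 \<and> real W \<le> 9 * ln (3 * real k)"
\<comment> \<open>The witness is left open here and becomes \<open>4 + 2 * j\<close>, where
  \<open>2 ^ j\<close> is the first power of two not below \<open>k\<close>.\<close>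
proof (intro exI conjI)
  define j where "j = nat \<lceil>log 2 (real k)\<rceil>"
  have log: "0 \<le> log 2 (real k)" using assms by simp
  have j: "log 2 (real k) \<le> real j" "real j \<le> log 2 (real k) + 1" using log unfolding j_def by linarith+
  have "real k = 2 powr (log 2 (real k))" using assms by simp
  also have "\<dots> \<le> 2 powr real j" using j by (intro powr_mono) auto
  also have "\<dots> = real (2 ^ j)" by (simp add: powr_realpow)
  finally have "k \<le> 2 ^ j" by (simp only: of_nat_le_iff)
  then have "16 * k\<^sup>2 \<le> 16 * (2 ^ j)\<^sup>2" by (intro mult_left_mono power_mono) auto
  also have "\<dots> = 2 ^ (4 + 2 * j)" by (simp add: power_add mult.commute[of 2 j] flip: power_mult)
  finally show "16 * k\<^sup>2 \<le> 2 ^ (4 + 2 * j)" .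
  have "log 2 (real k) \<le> 3 / 2 * ln (real k)"
  proof -
    have "ln (real k) \<ge> 0" using assms by simp
    then have "2 / 3 * ln (real k) \<le> ln 2 * ln (real k)" using ln2_ge_two_thirds by (intro mult_right_mono) auto
    moreover have "log 2 (real k) * ln 2 = ln (real k)" by (simp add: log_def)
    ultimately have "log 2 (real k) * ln 2 \<le> 3 / 2 * ln (real k) * ln 2" by (simp add: algebra_simps)
    then show ?thesis by (simp add: mult_le_cancel_right)
  qed
  moreover have "ln (3 * real k) = ln 3 + ln (real k)" using assms by (simp add: ln_mult)
  moreover have "ln 3 \<ge> (1::real)" using ln3_gt_1 by simp
  moreover have "ln (real k) \<ge> 0" using assms by simp
  moreover have "4 + 2 * (u + 1) \<le> 9 * v" if "u \<le> 3 / 2 * x" "v = y + x" "y \<ge> 1" "x \<ge> 0" for u v x y :: real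
    using that by simp
  ultimately have "4 + 2 * (log 2 (real k) + 1) \<le> 9 * ln (3 * real k)" by blast
  then show "real (4 + 2 * j) \<le> 9 * ln (3 * real k)" using j by simp
qed simp

lemma ln_ln_3_pos: "0 < ln (ln (3::real))"
  using ln3_gt_1 by simp

text \<open>Since \<open>ln (3 * k / m) \<ge> 1\<close>, the sum
  \<open>ln (3 * k) = ln m + ln (3 * k / m)\<close> is at most a product, so
  \<open>ln (m * W)\<close> is bounded by a multiple of \<open>ln m\<close>, plus
  \<open>ln (ln (3 * k / m))\<close>, plus a constant. The sum is turned into the required product
  because both of its factors are bounded below.\<close>

lemma collision_factor_le:
  fixes k m W :: nat
  assumes mk: "2 \<le> m" "m \<le> k" and W: "W > 0" "real W \<le> 9 * ln (3 * real k)"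
  shows "exp 5 * (1 + ln (real (m * W))) \<le>
    7 * exp 5 / ln (ln 3) * (ln (2 * real m) * ln (ln (3 * real k / real m)))"
proof -
  define l where "l = ln (ln (3 * real k / real m))"
  define c where "c = ln (ln (3::real))"
  have c: "0 < c" "c \<le> 1"
  proof -
    show "0 < c" unfolding c_def by (rule ln_ln_3_pos)
    have "ln 3 \<le> (2::real)" using ln_le_minus_one[of "3::real"] by simp
    then have "c \<le> ln 2" unfolding c_def using ln3_gt_1 by simp
    then show "c \<le> 1" using ln_le_minus_one[of "2::real"] by simp
  qed
  have K: "3 \<le> 3 * real k / real m" using mk by (simp add: field_simps)
  then have lnK: "ln 3 \<le> ln (3 * real k / real m)" by simp
  then have lnK1: "1 < ln (3 * real k / real m)" using ln3_gt_1 by linarith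
  have l: "c \<le> l" unfolding c_def l_def using lnK lnK1 ln3_gt_1 by simp
  have lnm: "0 \<le> ln (real m)" using mk by simp
  have b: "ln (2 * real m) = ln 2 + ln (real m)" using mk by (simp add: ln_mult)
  have "ln 4 = 2 * ln (2::real)" using ln_realpow[of 2 2] by simp
  moreover have "ln 4 \<le> ln (2 * real m)" using mk by simp
  ultimately have b1: "1 \<le> ln (2 * real m)" using ln2_ge_two_thirds by linarith
  have bm: "ln (real m) \<le> ln (2 * real m)" using b by simp
  have "ln (3 * real k) = ln (real m * (3 * real k / real m))" using mk by simp
  also have "\<dots> = ln (real m) + ln (3 * real k / real m)" using mk by (intro ln_mult_pos) auto
  also have "\<dots> \<le> (1 + ln (real m)) * ln (3 * real k / real m)"
    using mult_left_mono[of 1 "ln (3 * real k / real m)" "ln (real m)"] lnm lnK1 by (simp add: algebra_simps)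
  finally have ln3k: "ln (3 * real k) \<le> (1 + ln (real m)) * ln (3 * real k / real m)" .
  have "real (m * W) \<le> real m * (9 * ln (3 * real k))" using W by (simp add: mult_left_mono)
  also have "\<dots> \<le> real m * (9 * ((1 + ln (real m)) * ln (3 * real k / real m)))"
    using ln3k by (intro mult_left_mono) auto
  finally have "ln (real (m * W)) \<le> ln (real m * (9 * ((1 + ln (real m)) * ln (3 * real k / real m))))"
    using W mk by (intro ln_mono) auto
  also have "\<dots> = ln (real m) + (ln 9 + (ln (1 + ln (real m)) + l))"
    unfolding l_def using mk lnm lnK1 by (subst ln_mult_pos; (intro mult_pos_pos)?; simp add: ln_mult_pos add_pos_nonneg)
  also have "\<dots> \<le> 3 + 2 * ln (real m) + l"
  proof -
    have "ln 9 = 2 * ln (3::real)" using ln_realpow[of 3 2] by simp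
    moreover have "ln (3::real) \<le> 3 / 2"
    proof -
      have "exp (3 / 2 :: real) \<ge> (1 + (3 / 4))\<^sup>2"
        using power_mono[OF exp_ge_add_one_self[of "3 / 4 :: real"], of 2] by (simp add: exp_double[symmetric])
      then have "3 \<le> exp (3 / 2 :: real)" by (simp add: power2_eq_square)
      then show ?thesis by (metis ln_exp ln_mono zero_less_numeral)
    qed
    moreover have "ln (1 + ln (real m)) \<le> ln (real m)" using lnm by (intro ln_add_one_self_le_self)
    ultimately show ?thesis by linarith
  qed
  finally have "1 + ln (real (m * W)) \<le> 4 + 2 * ln (2 * real m) + l" using bm by linarith
  \<comment> \<open>With \<open>b \<ge> 1\<close> for \<open>ln (2 * m)\<close> and
    \<open>l \<ge> c\<close>, each of \<open>c\<close>, \<open>c * b\<close> and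
    \<open>c * l\<close> is at most \<open>b * l\<close>; the coefficients \<open>4 + 2 + 1\<close>
    add up to 7.\<close>
  also have "\<dots> \<le> 7 * (ln (2 * real m) * l) / c"
  proof -
    have bl: "c * ln (2 * real m) \<le> ln (2 * real m) * l" using l b1 by (simp add: mult.commute[of c] mult_left_mono)
    have "c * 1 \<le> c * ln (2 * real m)" using c b1 by (intro mult_left_mono) auto
    with bl have "c \<le> ln (2 * real m) * l" by simp
    moreover have "c * l \<le> ln (2 * real m) * l" using c l b1 by (intro mult_right_mono) auto
    ultimately have "c * (4 + 2 * ln (2 * real m) + l) \<le> 7 * (ln (2 * real m) * l)"
      using bl by (simp add: algebra_simps)
    then show ?thesis using c by (simp add: field_simps)
  qed
  finally have "exp 5 * (1 + ln (real (m * W))) \<le> exp 5 * (7 * (ln (2 * real m) * l) / c)"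
    by (rule mult_left_mono) simp
  also have "\<dots> = 7 * exp 5 / c * (ln (2 * real m) * l)" by simp
  finally show ?thesis unfolding l_def c_def .
qed

section \<open>Tuples in one residue class\<close>

lemma card_residue_class_le:
  assumes "q > 0"
  shows "real (card {y \<in> {- int N..int N}. y mod int q = c}) \<le> 2 * real N / real q + 2"
proof -
  let ?B = "{y \<in> {- int N..int N}. y mod int q = c}"
  have "inj_on (\<lambda>y. y div int q) ?B"
    by (rule inj_onI) (metis (mono_tags, lifting) mem_Collect_eq mult_div_mod_eq)
  moreover have "(\<lambda>y. y div int q) ` ?B \<subseteq> {(- int N) div int q..int N div int q}"
    using assms by (auto intro!: zdiv_mono1)
  ultimately have "card ?B \<le> card {(- int N) div int q..int N div int q}"
    by (intro card_inj_on_le[of _ ?B]) auto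
  also have "\<dots> = nat (int N div int q - (- int N) div int q + 1)" by simp
  finally have card: "card ?B \<le> nat (int N div int q - (- int N) div int q + 1)" .
  have "(- int N) div int q \<le> int N div int q" using assms by (intro zdiv_mono1) auto
  then have "real (nat (int N div int q - (- int N) div int q + 1)) =
      real_of_int (int N div int q) - real_of_int ((- int N) div int q) + 1" by simp
  moreover have "real_of_int (int N div int q) \<le> real N / real q"
    using floor_divide_of_int_eq[of "int N" "int q", where ?'a = real] of_int_floor_le[of "real N / real q"] by simp
  moreover have "real_of_int ((- int N) div int q) \<ge> - real N / real q - 1"
    using floor_divide_of_int_eq[of "- int N" "int q", where ?'a = real] real_of_int_floor_add_one_ge[of "- real N / real q"] by simp
  ultimately show ?thesis using card by linarith
qed

definition congruent_tuples :: "nat \<Rightarrow> nat \<Rightarrow> (nat \<Rightarrow> int) set" where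
  "congruent_tuples m q = {h \<in> {1..m} \<rightarrow>\<^sub>E UNIV. \<forall>i\<in>{1..m}. \<forall>j\<in>{1..m}. h i mod int q = h j mod int q}"

lemma card_congruent_tuples_le:
  assumes "m \<ge> 1" "q > 0"
  shows "real (card (congruent_tuples m q \<inter> ({1..m} \<rightarrow>\<^sub>E {- int N..int N}))) \<le>
    (2 * real N + 1) * (2 * real N / real q + 2) ^ (m - 1)"
proof -
  define C where "C = (\<lambda>x. {y \<in> {- int N..int N}. y mod int q = x mod int q})"
  \<comment> \<open>Coordinate 1 is pinned to \<open>x\<close> and the others range over its residue
    class, whence the exponent \<open>m - 1\<close>.\<close>
  let ?R = "\<lambda>x. PiE {1..m} (\<lambda>i. if i = 1 then {x} else C x)"
  have finC: "finite (C x)" for x unfolding C_def by (rule finite_subset[of _ "{- int N..int N}"]) auto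
  have fin: "finite (?R x)" for x using finC by (intro finite_PiE) auto
  have "congruent_tuples m q \<inter> ({1..m} \<rightarrow>\<^sub>E {- int N..int N}) \<subseteq> (\<Union>x\<in>{- int N..int N}. ?R x)"
  proof
    fix h assume h: "h \<in> congruent_tuples m q \<inter> ({1..m} \<rightarrow>\<^sub>E {- int N..int N})"
    have one: "1 \<in> {1..m}" using assms by simp
    have mem: "h i \<in> {- int N..int N}" if "i \<in> {1..m}" for i using h that by blast
    have eq: "h i mod int q = h 1 mod int q" if "i \<in> {1..m}" for i
      using h that one unfolding congruent_tuples_def by blast
    have "h \<in> ?R (h 1)"
    proof (rule PiE_I)
      fix i assume i: "i \<in> {1..m}"
      show "h i \<in> (if i = 1 then {h 1} else C (h 1))"
        using mem[OF i] eq[OF i] by (simp add: C_def)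
    next
      fix i assume i: "i \<notin> {1..m}"
      have "h \<in> {1..m} \<rightarrow>\<^sub>E {- int N..int N}" using h by (rule IntD2)
      then show "h i = undefined" using i by (rule PiE_arb)
    qed
    with mem[OF one] show "h \<in> (\<Union>x\<in>{- int N..int N}. ?R x)" by blast
  qed
  then have "card (congruent_tuples m q \<inter> ({1..m} \<rightarrow>\<^sub>E {- int N..int N})) \<le> card (\<Union>x\<in>{- int N..int N}. ?R x)"
    using fin by (intro card_mono) auto
  also have "\<dots> \<le> (\<Sum>x\<in>{- int N..int N}. card (?R x))" by (rule card_UN_le) simp
  finally have "real (card (congruent_tuples m q \<inter> ({1..m} \<rightarrow>\<^sub>E {- int N..int N}))) \<le> real (\<Sum>x\<in>{- int N..int N}. card (?R x))"
    by (simp only: of_nat_le_iff)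
  also have "\<dots> = (\<Sum>x\<in>{- int N..int N}. real (card (?R x)))" by (rule of_nat_sum)
  also have "\<dots> \<le> (\<Sum>x\<in>{- int N..int N}. (2 * real N / real q + 2) ^ (m - 1))"
  proof (rule sum_mono)
    fix x
    let ?f = "\<lambda>i::nat. if i = 1 then {x} else C x"
    have "real (card (?R x)) = (\<Prod>i\<in>{1..m}. real (card (?f i)))" by (simp add: card_PiE)
    also have "\<dots> = real (card (?f 1)) * (\<Prod>i\<in>{1..m} - {1}. real (card (?f i)))"
      using assms by (intro prod.remove) auto
    also have "\<dots> \<le> 1 * (\<Prod>i\<in>{1..m} - {1::nat}. 2 * real N / real q + 2)"
      using card_residue_class_le[OF assms(2), of N "x mod int q"]
      by (intro mult_mono prod_mono) (auto intro!: prod_nonneg simp: C_def)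
    also have "\<dots> = (2 * real N / real q + 2) ^ (m - 1)"     proof -
      have "card ({1..m} - {1::nat}) = m - 1" using assms by (subst card_Diff_singleton) auto
      then show ?thesis by simp
    qed
    finally show "real (card (?R x)) \<le> (2 * real N / real q + 2) ^ (m - 1)" .
  qed
  also have "\<dots> = (2 * real N + 1) * (2 * real N / real q + 2) ^ (m - 1)" by simp
  finally show ?thesis .
qed

text \<open>After division by the volume of the box, the free first coordinate contributes a factor
  tending to 1 and each of the others one tending to \<open>1 / q\<close>.\<close>

lemma lower_density_congruent_tuples_le:
  assumes "m \<ge> 1" "q > 0"
  shows "lower_density m (congruent_tuples m q) \<le> ereal ((1 / real q) ^ (m - 1))"
proof -
  have "lower_density m (congruent_tuples m q) \<le>
      liminf (\<lambda>N. ereal ((1 + 1 / 2 * (1 / real N)) * (1 / real q + 1 / real N) ^ (m - 1)))"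
    unfolding lower_density_def
  proof (rule Liminf_mono, rule eventually_sequentiallyI[of 1])
    fix N :: nat assume N: "1 \<le> N"
    let ?c = "real (card (congruent_tuples m q \<inter> ({1..m} \<rightarrow>\<^sub>E {- int N..int N})))"
    have "?c / (2 * real N) ^ m \<le> (2 * real N + 1) * (2 * real N / real q + 2) ^ (m - 1) / (2 * real N) ^ m"
      using card_congruent_tuples_le[OF assms] by (intro divide_right_mono) auto
    also have "\<dots> = (1 + 1 / 2 * (1 / real N)) * (1 / real q + 1 / real N) ^ (m - 1)"
    proof -
      have "m = Suc (m - 1)" using assms by simp
      then have "(2 * real N) ^ m = (2 * real N) * (2 * real N) ^ (m - 1)" by (metis power_Suc)
      then have "(2 * real N + 1) * (2 * real N / real q + 2) ^ (m - 1) / (2 * real N) ^ m =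
          (2 * real N + 1) / (2 * real N) * ((2 * real N / real q + 2) / (2 * real N)) ^ (m - 1)"
        by (simp only: power_divide times_divide_times_eq)
      moreover have "(2 * real N + 1) / (2 * real N) = 1 + 1 / 2 * (1 / real N)"
        using N by (simp add: field_simps)
      moreover have "(2 * real N / real q + 2) / (2 * real N) = 1 / real q + 1 / real N"
        using N assms by (simp add: field_simps)
      ultimately show ?thesis by simp
    qed
    finally show "ereal (?c / (2 * real N) ^ m) \<le> ereal ((1 + 1 / 2 * (1 / real N)) * (1 / real q + 1 / real N) ^ (m - 1))"
      by (simp only: ereal_less_eq)
  qed
  also have "\<dots> = ereal ((1 / real q) ^ (m - 1))"
  proof (rule lim_imp_Liminf)
    have "(\<lambda>N. (1 + 1 / 2 * (1 / real N)) * (1 / real q + 1 / real N) ^ (m - 1)) \<longlonglongrightarrow>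
        (1 + 1 / 2 * 0) * (1 / real q + 0) ^ (m - 1)"
      by (intro tendsto_intros lim_1_over_n)
    then show "(\<lambda>N. ereal ((1 + 1 / 2 * (1 / real N)) * (1 / real q + 1 / real N) ^ (m - 1))) \<longlonglongrightarrow>
        ereal ((1 / real q) ^ (m - 1))" by simp
  qed simp
  finally show ?thesis .
qed

section \<open>Pigeonhole in residue classes and the choice of the modulus\<close>

lemma pigeonhole_fiber:
  assumes "finite X" "(m - 1) * card (f ` X) < card X"
  shows "\<exists>Y\<subseteq>X. card Y = m \<and> (\<forall>x\<in>Y. \<forall>y\<in>Y. f x = f y)"
proof -
  have "\<exists>c\<in>f ` X. m \<le> card {x\<in>X. f x = c}"
  proof (rule ccontr)
    assume *: "\<not> ?thesis"
    have "X = (\<Union>c\<in>f ` X. {x\<in>X. f x = c})" by auto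
    then have "card X \<le> (\<Sum>c\<in>f ` X. card {x\<in>X. f x = c})"
      using card_UN_le[of "f ` X" "\<lambda>c. {x\<in>X. f x = c}"] assms(1) by simp
    also have "\<dots> \<le> (\<Sum>c\<in>f ` X. m - 1)" using * by (intro sum_mono) fastforce
    finally show False using assms(2) by (simp add: mult.commute)
  qed
  then obtain c where "m \<le> card {x\<in>X. f x = c}" by blast
  then obtain Y where "Y \<subseteq> {x\<in>X. f x = c}" "card Y = m" by (rule obtain_subset_with_card_n)
  then show ?thesis by (intro exI[of _ Y]) auto
qed

text \<open>More than \<open>(m - 1) * c\<close> points in at most \<open>c\<close> classes put
  \<open>m\<close> points into one class; congruence is stable under common shifts and
  reordering.\<close>

lemma plausible_congruent_tuples:
  assumes few: "\<And>X. finite X \<Longrightarrow> admissible X \<Longrightarrow> card ((\<lambda>x. x mod int q) ` X) \<le> c"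
    and c: "(m - 1) * c < k"
  shows "plausible m k (congruent_tuples m q)"
  unfolding plausible_def
proof (intro conjI ballI allI impI)
  show "congruent_tuples m q \<subseteq> {1..m} \<rightarrow>\<^sub>E UNIV" by (auto simp: congruent_tuples_def)
next
  fix h t assume "h \<in> congruent_tuples m q"
  then show "(\<lambda>i\<in>{1..m}. h i + t) \<in> congruent_tuples m q"
    unfolding congruent_tuples_def by (auto intro: mod_add_cong)
next
  fix h \<sigma> assume h: "h \<in> congruent_tuples m q" and \<sigma>: "\<sigma> permutes {1..m}"
  have "h \<circ> \<sigma> \<in> {1..m} \<rightarrow>\<^sub>E UNIV"
    using h permutes_not_in[OF \<sigma>] by (auto simp: congruent_tuples_def PiE_def extensional_def)
  moreover have "(h \<circ> \<sigma>) i mod int q = (h \<circ> \<sigma>) j mod int q" if "i \<in> {1..m}" "j \<in> {1..m}" for i j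
  proof -
    have "\<sigma> i \<in> {1..m}" "\<sigma> j \<in> {1..m}" using that permutes_in_image[OF \<sigma>] by blast+
    then show ?thesis using h unfolding congruent_tuples_def o_def by blast
  qed
  ultimately show "h \<circ> \<sigma> \<in> congruent_tuples m q"
    unfolding congruent_tuples_def by blast
next
  fix X :: "int set" assume X: "finite X \<and> card X = k \<and> admissible X"
  then have "(m - 1) * card ((\<lambda>x. x mod int q) ` X) \<le> (m - 1) * c" using few by (intro mult_left_mono) auto
  then have "(m - 1) * card ((\<lambda>x. x mod int q) ` X) < card X" using c X by linarith
  then obtain Y where Y: "Y \<subseteq> X" "card Y = m" "\<forall>x\<in>Y. \<forall>y\<in>Y. x mod int q = y mod int q"
    using pigeonhole_fiber[of X m "\<lambda>x. x mod int q"] X by blast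
  have "finite Y" using Y(1) X finite_subset by blast
  then obtain g where g: "bij_betw g {1..m} Y" using ex_bij_betw_nat_finite_1 Y(2) by blast
  let ?h = "\<lambda>i\<in>{1..m}. g i"
  have im: "?h ` {1..m} = Y" using g by (auto simp: bij_betw_def)
  then have mem: "?h i \<in> Y" if "i \<in> {1..m}" for i using that by blast
  have "?h \<in> congruent_tuples m q"
    unfolding congruent_tuples_def using Y(3) mem by auto
  moreover have "inj_on ?h {1..m}" using g by (simp add: bij_betw_def)
  moreover have "?h ` {1..m} \<subseteq> X" using im Y(1) by blast
  ultimately show "\<exists>h\<in>congruent_tuples m q. inj_on h {1..m} \<and> h ` {1..m} \<subseteq> X" by blast
qed

text \<open>An admissible set misses a class modulo each prime up to \<open>y\<close>. The residues
  modulo \<open>r\<close> times the primorial form \<open>r\<close> whole periods of the primorial,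
  so the exact sieve count applies even when \<open>r\<close> shares prime factors with it.\<close>

lemma card_admissible_residues_le:
  fixes y r :: nat
  assumes "admissible X" "r > 0"
  shows "card ((\<lambda>x. x mod int (r * \<Prod>(primes_upto y))) ` X) \<le> r * (\<Prod>p\<in>primes_upto y. p - 1)"
proof -
  let ?P = "primes_upto y"
  let ?q = "r * \<Prod>?P"
  obtain a where a: "\<And>p. prime p \<Longrightarrow> \<forall>x\<in>X. \<not> [x = a p] (mod int p)"
    using assms(1) unfolding admissible_def by metis
  let ?B = "{x \<in> {0..<0 + int r * int (\<Prod>?P)}. \<forall>p\<in>?P. x mod int p \<notin> {a p mod int p}}"
  have "?q > 0" using assms(2) by (auto intro!: prod_pos simp: prime_gt_0_nat)
  then have q: "int ?q > 0" by (simp only: of_nat_0_less_iff)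
  have "(\<lambda>x. x mod int ?q) ` X \<subseteq> ?B"
  proof (rule image_subsetI, safe)
    fix x assume x: "x \<in> X"
    show "x mod int ?q \<in> {0..<0 + int r * int (\<Prod>?P)}"
      using pos_mod_sign[OF q, of x] pos_mod_bound[OF q, of x] by simp
  next
    fix x p assume x: "x \<in> X" and p: "prime p" "p \<le> y" and eq: "x mod int ?q mod int p = a p mod int p"
    have "p dvd ?q" using p by (intro dvd_mult dvd_prodI[where f = "\<lambda>x. x", simplified]) (auto simp: finite_primes_le)
    then have "int p dvd int ?q" by (simp only: int_dvd_int_iff)
    then have "x mod int p = a p mod int p" using eq by (simp only: mod_mod_cancel)
    then show False using a[OF p(1)] x by (auto simp: cong_def)
  qed
  then have "card ((\<lambda>x. x mod int ?q) ` X) \<le> card ?B"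
    by (intro card_mono finite_subset[of ?B "{0..<0 + int r * int (\<Prod>?P)}"]) auto
  moreover have "real (card ?B) = real r * (\<Prod>p\<in>?P. real p - real (card {a p mod int p}))"
    by (rule card_avoiding_residues) (auto simp: finite_primes_le prime_gt_0_nat)
  moreover have "(\<Prod>p\<in>?P. real p - real (card {a p mod int p})) = (\<Prod>p\<in>?P. real (p - 1))"
    by (intro prod.cong refl) (simp add: of_nat_diff prime_ge_Suc_0_nat)
  ultimately have "real (card ((\<lambda>x. x mod int ?q) ` X)) \<le> real (r * (\<Prod>p\<in>?P. p - 1))" by simp
  then show ?thesis by (simp only: of_nat_le_iff)
qed

lemma delta_le_inverse_power:
  assumes "1 \<le> m" "r > 0" "(m - 1) * (r * (\<Prod>p\<in>primes_upto y. p - 1)) < k"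
  shows "delta m k \<le> ereal ((1 / real (r * \<Prod>(primes_upto y))) ^ (m - 1))"
proof -
  define q where "q = r * \<Prod>(primes_upto y)"
  have "q > 0" unfolding q_def using assms(2) by (auto intro!: prod_pos simp: prime_gt_0_nat)
  then have "lower_density m (congruent_tuples m q) \<le> ereal ((1 / real q) ^ (m - 1))"
    by (rule lower_density_congruent_tuples_le[OF assms(1)])
  moreover have "plausible m k (congruent_tuples m q)"
    unfolding q_def using card_admissible_residues_le[OF _ assms(2)] assms(3) by (rule plausible_congruent_tuples)
  ultimately show ?thesis unfolding delta_def q_def by (intro INF_lower2) auto
qed

lemma delta_le_1:
  assumes "1 \<le> m" "m \<le> k"
  shows "delta m k \<le> 1"
proof -
  \<comment> \<open>With \<open>r = 1\<close> and \<open>y = 0\<close> the modulus is 1, and the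
    plausible set consists of all tuples.\<close>
  have none: "primes_upto 0 = {}" by auto
  show ?thesis using delta_le_inverse_power[OF assms(1), of 1 0 k] assms unfolding none by (simp add: one_ereal_def)
qed

text \<open>Among moduli whose admissible sets meet at most \<open>X\<close> classes, one wants the
  largest. Sieving by all primes up to \<open>y\<close> gains the Euler product, at least
  \<open>ln (y + 1)\<close> by the harmonic sum, and \<open>r\<close> fills up the remaining
  room.\<close>

lemma exists_modulus:
  assumes "X \<ge> 1"
  shows "\<exists>r y. r > 0 \<and> r * (\<Prod>p\<in>primes_upto y. p - 1) \<le> X \<and>
    real X * ln (ln (6 * real X)) / 8 \<le> real (r * \<Prod>(primes_upto y))"
proof -
  \<comment> \<open>Chosen so that \<open>\<phi> \<le> exp (y ^ 2) \<le> X\<close> by the crudest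
    estimate; the square root only halves \<open>ln (ln X)\<close>.\<close>
  define t where "t = sqrt (ln (real X))"
  define y where "y = nat \<lfloor>t\<rfloor>"
  define \<phi> where "\<phi> = (\<Prod>p\<in>primes_upto y. p - 1)"
  define P where "P = \<Prod>(primes_upto y)"
  define r where "r = X div \<phi>"
  have lnX: "ln (real X) \<ge> 0" using assms by simp
  then have t: "t \<ge> 0" "t\<^sup>2 = ln (real X)" by (auto simp: t_def)
  have y: "real y \<le> t" "t < real y + 1" using t(1) unfolding y_def by linarith+
  have "real \<phi> = (\<Prod>p\<in>primes_upto y. real (p - 1))" by (simp add: \<phi>_def)
  also have "\<dots> \<le> (\<Prod>p\<in>primes_upto y. exp (real y))"
  proof (rule prod_mono, rule conjI)
    fix p assume "p \<in> primes_upto y"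
    then have "real (p - 1) \<le> real y" by auto
    also have "\<dots> \<le> exp (real y)" using exp_ge_add_one_self[of "real y"] by linarith
    finally show "real (p - 1) \<le> exp (real y)" .
  qed simp
  also have "\<dots> = exp (real y) ^ card (primes_upto y)" by simp
  also have "\<dots> \<le> exp (real y) ^ y"
  proof -
    have "card (primes_upto y) \<le> card {1..y}" by (intro card_mono) (auto simp: prime_ge_Suc_0_nat)
    then show ?thesis by (intro power_increasing) auto
  qed
  also have "\<dots> = exp ((real y)\<^sup>2)" by (simp add: exp_of_nat_mult[symmetric] power2_eq_square)
  also have "\<dots> \<le> exp (t\<^sup>2)" using power_mono[OF y(1), of 2] by simp
  also have "\<dots> = real X" using t assms by simp
  finally have \<phi>X: "\<phi> \<le> X" by simp
  have \<phi>: "\<phi> > 0" unfolding \<phi>_def by (intro prod_pos) (auto dest: prime_gt_1_nat)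
  have r: "r > 0" using \<phi>X \<phi> by (simp add: r_def div_greater_zero_iff)
  have "X = \<phi> * r + X mod \<phi>" by (simp add: r_def)
  moreover have "X mod \<phi> < \<phi>" using \<phi> by simp
  moreover have "\<phi> * 1 \<le> \<phi> * r" using r by (intro mult_left_mono) auto
  \<comment> \<open>Rounding in \<open>X div \<phi>\<close> loses at most a factor 2; with the 4 in
    the bound for \<open>ln (ln (6 * X))\<close> this makes the 8.\<close>
  ultimately have "X \<le> 2 * (\<phi> * r)" by linarith
  then have Xr: "real X \<le> 2 * (real \<phi> * real r)" by (metis of_nat_le_iff of_nat_mult of_nat_numeral)
  have ratio: "real P / real \<phi> = (\<Prod>p\<in>primes_upto y. real p / (real p - 1))"
    unfolding P_def \<phi>_def of_nat_prod prod_dividef[symmetric]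
    by (intro prod.cong refl) (simp add: of_nat_diff prime_ge_Suc_0_nat)
  have "ln (real y + 1) \<le> (\<Sum>n=1..y. 1 / real n)"
    using ln_le_harm[of y] by (simp add: harm_def divide_inverse)
  also have "\<dots> \<le> real P / real \<phi>" unfolding ratio by (rule harmonic_sum_le_euler_product)
  finally have R1: "ln (real y + 1) \<le> real P / real \<phi>" .
  have R2: "1 \<le> real P / real \<phi>"
    unfolding ratio by (rule prod_ge_1) (auto dest: prime_gt_1_real)
  have "ln (6 * real X) = ln 6 + t\<^sup>2" using assms t by (simp add: ln_mult)
  also have "\<dots> \<le> 2 + t\<^sup>2"
  proof -
    have "exp (2::real) \<ge> (1 + 1 + 1\<^sup>2 / 2)\<^sup>2"
      using power_mono[OF exp_lower_Taylor_quadratic[of "1::real"], of 2] by (simp add: exp_double[symmetric])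
    then have "6 \<le> exp (2::real)" by (simp add: power2_eq_square)
    then show ?thesis by (metis add_right_mono ln_exp ln_mono zero_less_numeral)
  qed
  also have "\<dots> \<le> 2 * (real y + 1)\<^sup>2 + (real y + 1)\<^sup>2"
  proof (rule add_mono)
    show "2 \<le> 2 * (real y + 1)\<^sup>2" using power_mono[of 1 "real y + 1" 2] by simp
    show "t\<^sup>2 \<le> (real y + 1)\<^sup>2" using y t by (intro power_mono) auto
  qed
  finally have "ln (6 * real X) \<le> 3 * (real y + 1)\<^sup>2" by simp
  moreover have "ln (6 * real X) > 0" using assms by simp
  ultimately have "ln (ln (6 * real X)) \<le> ln (3 * (real y + 1)\<^sup>2)" by simp
  also have "\<dots> = ln 3 + 2 * ln (real y + 1)" by (simp add: ln_mult ln_realpow)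
  also have "\<dots> \<le> 2 + 2 * ln (real y + 1)" using ln_le_minus_one[of "3::real"] by simp
  also have "\<dots> \<le> 4 * (real P / real \<phi>)" using R1 R2 by linarith
  finally have ll: "ln (ln (6 * real X)) \<le> 4 * (real P / real \<phi>)" .
  have "real X * ln (ln (6 * real X)) / 8 \<le> real X * (4 * (real P / real \<phi>)) / 8"
    using ll by (intro divide_right_mono mult_left_mono) auto
  also have "\<dots> \<le> 2 * (real \<phi> * real r) * (4 * (real P / real \<phi>)) / 8"
    using Xr by (intro divide_right_mono mult_right_mono) auto
  also have "\<dots> = real (r * P)" using \<phi> by simp
  finally have "real X * ln (ln (6 * real X)) / 8 \<le> real (r * P)" .
  moreover have "r * \<phi> \<le> X" by (simp add: r_def)
  ultimately show ?thesis using r unfolding \<phi>_def P_def by blast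
qed

text \<open>\<open>X\<close> is the largest number of classes for which the pigeonhole still yields
  \<open>m\<close> points in one of them. Rounding gives \<open>k / m \<le> 2 * X\<close>, which
  turns the 8 into 16 and explains the 6 inside the logarithm.\<close>

lemma delta_upper_bound:
  assumes "2 \<le> m" "m \<le> k"
  shows "delta m k \<le> ereal ((16 / (real k / real m * ln (ln (3 * real k / real m)))) ^ (m - 1))"
proof -
  define X where "X = (k - 1) div (m - 1)"
  have X: "X \<ge> 1" using assms by (simp add: X_def less_eq_div_iff_mult_less_eq)
  obtain r y where ry: "r > 0" "r * (\<Prod>p\<in>primes_upto y. p - 1) \<le> X"
      "real X * ln (ln (6 * real X)) / 8 \<le> real (r * \<Prod>(primes_upto y))"
    using exists_modulus[OF X] by blast
  have "(m - 1) * (r * (\<Prod>p\<in>primes_upto y. p - 1)) \<le> (m - 1) * X"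
    using ry(2) by (intro mult_left_mono) auto
  also have "\<dots> \<le> k - 1" by (simp add: X_def)
  also have "\<dots> < k" using assms by simp
  finally have upper: "delta m k \<le> ereal ((1 / real (r * \<Prod>(primes_upto y))) ^ (m - 1))"
    using ry(1) assms by (intro delta_le_inverse_power) auto
  have "k - 1 < (m - 1) * (X + 1)"
    using dividend_less_times_div[of "m - 1" "k - 1"] assms by (simp add: X_def)
  then have "k \<le> (m - 1) * (X + 1)" by linarith
  also have "\<dots> \<le> m * (2 * X)" using X by (intro mult_mono) auto
  finally have "real k \<le> real (m * (2 * X))" by (simp only: of_nat_le_iff)
  then have KX: "real k / real m \<le> 2 * real X" using assms by (simp add: field_simps)
  define l where "l = ln (ln (3 * real k / real m))"
  have K: "1 \<le> real k / real m" using assms by simp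
  then have "ln 3 \<le> ln (3 * real k / real m)" by simp
  then have l3: "1 < ln (3 * real k / real m)" using ln3_gt_1 by linarith
  then have l: "l > 0" unfolding l_def by simp
  have "ln (3 * real k / real m) \<le> ln (6 * real X)"
    using KX K by (intro ln_mono) auto
  then have lX: "l \<le> ln (ln (6 * real X))" unfolding l_def by (subst ln_le_cancel_iff) (use l3 in linarith)+
  have "real k / real m * l / 16 \<le> 2 * real X * ln (ln (6 * real X)) / 16"
    using KX lX l by (intro divide_right_mono mult_mono) auto
  also have "\<dots> \<le> real (r * \<Prod>(primes_upto y))" using ry(3) by simp
  finally have ge: "real k / real m * l / 16 \<le> real (r * \<Prod>(primes_upto y))" .
  have pos: "real k / real m * l > 0" using K l by (intro mult_pos_pos) auto
  have "(1 / q) ^ n \<le> (16 / x) ^ n" if "x / 16 \<le> q" "x > 0" for q x :: real and n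
    using that by (intro power_mono) (auto simp: field_simps)
  from this[OF ge pos] have "(1 / real (r * \<Prod>(primes_upto y))) ^ (m - 1) \<le> (16 / (real k / real m * l)) ^ (m - 1)" .
  with upper show ?thesis unfolding l_def by (meson ereal_less_eq(3) order_trans)
qed

section \<open>Proof of the theorem\<close>

lemma delta_ge:
  assumes "\<And>A. plausible m k A \<Longrightarrow> x \<le> lower_density m A"
  shows "x \<le> delta m k"
  unfolding delta_def using assms by (intro INF_greatest) auto

lemma one_le_ln_double:
  assumes "2 \<le> m"
  shows "ln 4 \<le> ln (2 * real m)" "1 \<le> ln (2 * real m)"
proof -
  have "ln 4 = 2 * ln (2::real)" using ln_realpow[of 2 2] by simp
  moreover show "ln 4 \<le> ln (2 * real m)" using assms by simp
  ultimately show "1 \<le> ln (2 * real m)" using ln2_ge_two_thirds by linarith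
qed

text \<open>With \<open>W\<close> of order \<open>ln (3 * k)\<close>, the loss beyond the main term
  is arranged as an \<open>m\<close>-th power of a constant times \<open>ln (2 * m)\<close>, the
  shape that an exponent of size \<open>O(m)\<close> can absorb.\<close>

lemma delta_lower_bound:
  fixes k m :: nat
  defines "E \<equiv> 4 * (exp 1)\<^sup>2" and "c \<equiv> 7 * exp 5 / ln (ln 3)"
  assumes mk: "2 \<le> m" "m \<le> k"
  shows "ereal (1 / ((2 * E * (1 + c) * ln (2 * real m)) ^ m *
      (real k / real m * ln (ln (3 * real k / real m))) ^ (m - 1))) \<le> delta m k"
proof -
  define l where "l = ln (ln (3 * real k / real m))"
  define b where "b = ln (2 * real m)"
  define K where "K = real k / real m"
  have b: "1 \<le> b" unfolding b_def by (rule one_le_ln_double[OF mk(1)])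
  have E: "E > 0" by (simp add: E_def)
  have c: "c > 0" using ln_ln_3_pos by (simp add: c_def)
  have K: "1 \<le> K" using mk by (simp add: K_def)
  have "ln 3 \<le> ln (3 * real k / real m)" using mk by (simp add: field_simps)
  then have "1 < ln (3 * real k / real m)" using ln3_gt_1 by linarith
  then have l: "l > 0" by (simp add: l_def)
  obtain W where W: "16 * k\<^sup>2 \<le> 2 ^ W" "W > 0" "real W \<le> 9 * ln (3 * real k)"
    using exists_collision_threshold[of k] mk by auto
  define G where "G = exp 5 * (1 + ln (real (m * W)))"
  have G: "G \<le> c * (b * l)"
    unfolding G_def c_def b_def l_def by (rule collision_factor_le[OF mk W(2,3)])
  have "real (m * W) \<ge> 1" using mk W(2) by (simp del: of_nat_mult add: Suc_leI)
  then have "ln (real (m * W)) \<ge> 0" by (simp only: ln_ge_zero)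
  then have G0: "G > 0" by (simp add: G_def)
  have "m = Suc (m - 1)" using mk by simp
  then have pow: "x ^ m = x * x ^ (m - 1)" for x :: real by (metis power_Suc)
  have "(E * K) ^ m * G ^ (m - 1) \<le> (E * K) ^ m * (c * (b * l)) ^ (m - 1)"
    using G G0 E K by (intro mult_left_mono power_mono) auto
  also have "\<dots> = (E * K) * (E * c * b) ^ (m - 1) * (K * l) ^ (m - 1)"
    by (simp only: pow power_mult_distrib mult_ac)
  also have "\<dots> \<le> (E * K) * (2 * E * (1 + c) * b) ^ (m - 1) * (K * l) ^ (m - 1)"
    using E c b K l by (intro mult_right_mono mult_left_mono power_mono) (auto simp: algebra_simps)
  finally have "(E * K) ^ m * G ^ (m - 1) \<le> (E * K) * (2 * E * (1 + c) * b) ^ (m - 1) * (K * l) ^ (m - 1)" .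
  also have "\<dots> \<le> real k / 2 * ((2 * E * (1 + c) * b) ^ m * (K * l) ^ (m - 1))"
  proof -
    \<comment> \<open>The main term has exponent \<open>m - 1\<close>, while \<open>E * K\<close>
      occurs \<open>m\<close> times. The surplus factor is paid for by the \<open>k / 2\<close> of
      the deletion argument.\<close>
    have "K \<le> real k" using mk by (simp add: K_def field_simps)
    then have "E * K \<le> E * real k * 1" using E by simp
    also have "\<dots> \<le> E * real k * ((1 + c) * b)"
      using E b c mult_mono[of 1 "1 + c" 1 b] by (intro mult_left_mono) auto
    also have "\<dots> = real k / 2 * (2 * E * (1 + c) * b)" by (simp add: field_simps)
    finally have EK: "E * K \<le> real k / 2 * (2 * E * (1 + c) * b)" .
    have "0 \<le> (2 * E * (1 + c) * b) ^ (m - 1) * (K * l) ^ (m - 1)"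
      using E c b K l by (intro mult_nonneg_nonneg zero_le_power) auto
    from mult_right_mono[OF EK this] show ?thesis
      unfolding pow[of "2 * E * (1 + c) * b"] by (simp only: mult.assoc)
  qed
  finally have le: "(E * K) ^ m * G ^ (m - 1) \<le> real k / 2 * ((2 * E * (1 + c) * b) ^ m * (K * l) ^ (m - 1))" .
  have "1 / Y \<le> x / Z" if "Z \<le> x * Y" "Z > 0" "Y > 0" for x Y Z :: real
    using that by (simp add: field_simps)
  from this[OF le] have "1 / ((2 * E * (1 + c) * b) ^ m * (K * l) ^ (m - 1)) \<le> real k / 2 / ((E * K) ^ m * G ^ (m - 1))"
    using E K G0 c b l by (auto intro!: mult_pos_pos)
  moreover have "ereal (real k / 2 / ((E * K) ^ m * G ^ (m - 1))) \<le> delta m k"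
    using mk lower_density_plausible_ge[OF _ _ mk(2) W(1)]
    by (intro delta_ge) (simp add: E_def K_def G_def)
  ultimately show ?thesis unfolding b_def K_def l_def by (meson ereal_less_eq(3) order_trans)
qed

text \<open>For \<open>m = 1\<close> the collision factor has exponent 0 and \<open>k\<close>
  cancels, so any admissible threshold \<open>W\<close> gives the same constant.\<close>

lemma delta_1_ge:
  assumes "1 \<le> k"
  shows "ereal (1 / (8 * (exp 1)\<^sup>2)) \<le> delta 1 k"
proof -
  obtain W :: nat where "16 * k\<^sup>2 \<le> 2 ^ W"
    using exists_collision_threshold[of k] assms by auto
  from lower_density_plausible_ge[OF _ _ _ this, of 1] show ?thesis
    using assms by (intro delta_ge) simp
qed

section \<open>Converting two-sided bounds into an exponent\<close>

text \<open>The exponent is \<open>ln r / ln b\<close>. Absolute values allow a base below 1, as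
  happens for \<open>m = 1\<close> with base \<open>ln 2\<close>.\<close>

lemma exists_log_exponent:
  assumes "b > 0" "ln b \<noteq> 0" "r > 0" "\<bar>ln r\<bar> \<le> x * \<bar>ln b\<bar>"
  shows "\<exists>\<theta>. \<bar>\<theta>\<bar> \<le> x \<and> r = b powr (\<theta> :: real)"
proof (intro exI conjI)
  show "\<bar>ln r / ln b\<bar> \<le> x" using assms by (simp add: abs_divide pos_divide_le_eq)
  show "r = b powr (ln r / ln b)" using assms by (simp add: powr_def)
qed

lemma ereal_between:
  assumes "ereal u \<le> x" "x \<le> ereal v"
  obtains d where "x = ereal d" "u \<le> d" "d \<le> v"
  using assms by (cases x) auto

text \<open>The ratio of \<open>delta m k\<close> to the main term lies between
  \<open>(B * b) ^ m\<close> and its inverse, where adding 16 in \<open>B\<close> makes one constant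
  serve both bounds. As \<open>b = ln (2 * m) \<ge> ln 4 > 1\<close>, its logarithm stays away from
  0 and the constant \<open>B\<close> is itself at most a bounded power of \<open>b\<close>.\<close>

lemma delta_exponent_ge_2:
  defines "B \<equiv> 2 * (4 * (exp 1)\<^sup>2) * (1 + 7 * exp 5 / ln (ln 3)) + 16"
  assumes mk: "2 \<le> m" "m \<le> k"
  shows "\<exists>\<theta>. \<bar>\<theta>\<bar> \<le> (ln B / ln (ln 4) + 1) * real m \<and>
    delta m k = ereal (ln (2 * real m) powr \<theta> / (real k / real m * ln (ln (3 * real k / real m))) ^ (m - 1))"
proof -
  define D where "D = (real k / real m * ln (ln (3 * real k / real m))) ^ (m - 1)"
  define b where "b = ln (2 * real m)"
  define B' :: real where "B' = 2 * (4 * (exp 1)\<^sup>2) * (1 + 7 * exp 5 / ln (ln 3))"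
  have B': "0 < B'" "B = B' + 16"
    using ln_ln_3_pos by (auto simp: B'_def B_def intro!: mult_pos_pos add_pos_pos)
  have "ln 4 > (1::real)"
  proof -
    have "ln 4 = 2 * ln (2::real)" using ln_realpow[of 2 2] by simp
    then show ?thesis using ln2_ge_two_thirds by linarith
  qed
  then have b: "1 < b" "ln 4 \<le> b" using one_le_ln_double[OF mk(1)] by (auto simp: b_def)
  then have lnb: "0 < ln (ln 4 :: real)" "ln (ln 4) \<le> ln b" using \<open>ln 4 > 1\<close> by auto
  have "ln 3 \<le> ln (3 * real k / real m)" using mk by (simp add: field_simps)
  then have "1 < ln (3 * real k / real m)" using ln3_gt_1 by linarith
  then have D: "D > 0" using mk by (auto simp: D_def)
  have low: "ereal (1 / ((B' * b) ^ m * D)) \<le> delta m k"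
    using delta_lower_bound[OF mk] by (simp only: D_def b_def B'_def)
  have "delta m k \<le> ereal (16 ^ (m - 1) / D)"
    using delta_upper_bound[OF mk] by (simp only: D_def power_divide)
  with low obtain d where d: "delta m k = ereal d" "1 / ((B' * b) ^ m * D) \<le> d" "d \<le> 16 ^ (m - 1) / D"
    by (rule ereal_between)
  define r where "r = d * D"
  have "1 / ((B' * b) ^ m * D) * D \<le> r" unfolding r_def using d(2) D by (intro mult_right_mono) auto
  then have r1: "1 / (B' * b) ^ m \<le> r" using D by simp
  have r2: "r \<le> 16 ^ (m - 1)" using d(3) D by (simp add: r_def field_simps)
  have Bb: "0 < B' * b" "0 < B * b" "B' * b \<le> B * b" "16 \<le> B * b" using B' b mult_mono[of 16 B 1 b] by auto
  then have "0 < 1 / (B' * b) ^ m" by simp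
  with r1 have r0: "r > 0" by linarith
  have "1 / (B * b) ^ m \<le> 1 / (B' * b) ^ m"
    using Bb B' b by (intro divide_left_mono power_mono mult_pos_pos zero_less_power) auto
  with r1 have "1 / (B * b) ^ m \<le> r" by linarith
  then have "ln (1 / (B * b) ^ m) \<le> ln r" using Bb by (intro ln_mono) auto
  moreover have "ln (1 / (B * b) ^ m) = - real m * ln (B * b)"
  proof -
    have "ln (1 / x ^ m) = - real m * ln x" if "x > 0" for x :: real
      using that by (simp add: ln_div ln_realpow)
    then show ?thesis using Bb(2) by blast
  qed
  ultimately have ge: "- (real m * ln (B * b)) \<le> ln r" by simp
  have "(16::real) ^ (m - 1) \<le> 16 ^ m" by (intro power_increasing) auto
  with r2 have "r \<le> 16 ^ m" by linarith
  also have "\<dots> \<le> (B * b) ^ m" using Bb by (intro power_mono) auto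
  finally have "ln r \<le> ln ((B * b) ^ m)" using r0 by (intro ln_mono)
  then have "ln r \<le> real m * ln (B * b)" using Bb by (simp add: ln_realpow)
  with ge have abs: "\<bar>ln r\<bar> \<le> real m * ln (B * b)" by linarith
  have "ln (B * b) = ln B + ln b" using B' b by (intro ln_mult_pos) auto
  also have "\<dots> \<le> (ln B / ln (ln 4) + 1) * ln b"
  proof -
    have "ln B \<ge> 0" using B' by simp
    then have "ln B * ln (ln 4) \<le> ln B * ln b" using lnb by (intro mult_left_mono) auto
    then have "ln B \<le> ln B / ln (ln 4) * ln b" using lnb(1) by (simp add: field_simps)
    then show ?thesis by (simp add: algebra_simps)
  qed
  finally have "real m * ln (B * b) \<le> real m * ((ln B / ln (ln 4) + 1) * ln b)"
    by (rule mult_left_mono) simp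
  with abs have "\<bar>ln r\<bar> \<le> real m * ((ln B / ln (ln 4) + 1) * ln b)" by linarith
  moreover have "ln b = \<bar>ln b\<bar>" using b(1) by simp
  ultimately have "\<bar>ln r\<bar> \<le> (ln B / ln (ln 4) + 1) * real m * \<bar>ln b\<bar>"
    by (metis mult.assoc mult.commute)
  then obtain \<theta> where "\<bar>\<theta>\<bar> \<le> (ln B / ln (ln 4) + 1) * real m" "r = b powr \<theta>"
    using exists_log_exponent[of b r] b lnb r0 by auto
  moreover have "d = r / D" using D by (simp add: r_def)
  ultimately show ?thesis using d(1) unfolding b_def D_def by auto
qed

text \<open>For \<open>m = 1\<close> the denominator is an empty power, and \<open>delta\<close>
  lies between an absolute positive constant and 1, hence is a bounded power of
  \<open>ln 2\<close>.\<close>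

lemma delta_exponent_1:
  assumes "1 \<le> k"
  shows "\<exists>\<theta>. \<bar>\<theta>\<bar> \<le> ln (8 * (exp 1)\<^sup>2) / \<bar>ln (ln 2)\<bar> \<and> delta 1 k = ereal (ln 2 powr \<theta>)"
proof -
  have "delta 1 k \<le> ereal 1" using delta_le_1[of 1 k] assms by (simp add: one_ereal_def)
  with delta_1_ge[OF assms] obtain d where d: "delta 1 k = ereal d" "1 / (8 * (exp 1)\<^sup>2) \<le> d" "d \<le> 1"
    by (rule ereal_between)
  have pos: "0 < 1 / (8 * (exp 1 :: real)\<^sup>2)" by simp
  then have d0: "d > 0" using d(2) by linarith
  have "ln (1 / (8 * (exp 1)\<^sup>2)) \<le> ln d" using d(2) pos by (intro ln_mono)
  moreover have "ln (1 / (8 * (exp 1 :: real)\<^sup>2)) = - ln (8 * (exp 1)\<^sup>2)" by (simp add: ln_div)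
  moreover have "ln d \<le> 0" using d(3) d0 by simp
  ultimately have abs: "\<bar>ln d\<bar> \<le> ln (8 * (exp 1)\<^sup>2)" by linarith
  have "ln 2 < (1::real)" using ln_less_self[of 2] ln_add_one_self_le_self[of "1::real"] ln_2_less_1 by simp
  then have "ln (ln 2 :: real) < 0" by (simp add: ln_less_zero)
  then have "\<exists>\<theta>. \<bar>\<theta>\<bar> \<le> ln (8 * (exp 1)\<^sup>2) / \<bar>ln (ln 2)\<bar> \<and> d = ln 2 powr \<theta>"
    using abs d0 by (intro exists_log_exponent) auto
  with d(1) show ?thesis by auto
qed

theorem theorem1:
  "\<exists>C::real. C > 0 \<and>
     (\<forall>k m :: nat. 1 \<le> m \<and> m \<le> k \<longrightarrow>
        (\<exists>\<theta>::real. \<bar>\<theta>\<bar> \<le> C * real m \<and>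
           delta m k =
             ereal (ln (2 * real m) powr \<theta> /
                    (real k / real m * ln (ln (3 * real k / real m))) ^ (m - 1))))"
proof -
  define C1 :: real where "C1 = ln (8 * (exp 1)\<^sup>2) / \<bar>ln (ln 2)\<bar>"
  define C2 :: real where "C2 = ln (2 * (4 * (exp 1)\<^sup>2) * (1 + 7 * exp 5 / ln (ln 3)) + 16) / ln (ln 4) + 1"
  show ?thesis
  \<comment> \<open>\<open>C1\<close> serves \<open>m = 1\<close> and \<open>C2\<close> serves
    \<open>m \<ge> 2\<close>; absolute values and the added 1 make the common constant visibly
    positive.\<close>
  proof (rule exI[of _ "\<bar>C1\<bar> + \<bar>C2\<bar> + 1"], intro conjI allI impI)
    fix k m :: nat assume mk: "1 \<le> m \<and> m \<le> k"
    have "\<exists>\<theta>. \<bar>\<theta>\<bar> \<le> max C1 C2 * real m \<and> delta m k =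
        ereal (ln (2 * real m) powr \<theta> / (real k / real m * ln (ln (3 * real k / real m))) ^ (m - 1))"
    proof (cases "m = 1")
      case True
      obtain \<theta> where "\<bar>\<theta>\<bar> \<le> C1" "delta 1 k = ereal (ln 2 powr \<theta>)"
        using delta_exponent_1[of k] mk unfolding C1_def by auto
      with True show ?thesis by (intro exI[of _ \<theta>]) auto
    next
      case False
      with mk have m: "2 \<le> m" "m \<le> k" by auto
      obtain \<theta> where \<theta>: "\<bar>\<theta>\<bar> \<le> C2 * real m" "delta m k =
          ereal (ln (2 * real m) powr \<theta> / (real k / real m * ln (ln (3 * real k / real m))) ^ (m - 1))"
        using delta_exponent_ge_2[OF m] unfolding C2_def by blast
      have "C2 * real m \<le> max C1 C2 * real m" by (intro mult_right_mono) auto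
      with \<theta> show ?thesis by (meson order_trans)
    qed
    then obtain \<theta> where \<theta>: "\<bar>\<theta>\<bar> \<le> max C1 C2 * real m" "delta m k =
        ereal (ln (2 * real m) powr \<theta> / (real k / real m * ln (ln (3 * real k / real m))) ^ (m - 1))" by blast
    have "max C1 C2 * real m \<le> (\<bar>C1\<bar> + \<bar>C2\<bar> + 1) * real m" by (intro mult_right_mono) auto
    with \<theta> show "\<exists>\<theta>. \<bar>\<theta>\<bar> \<le> (\<bar>C1\<bar> + \<bar>C2\<bar> + 1) * real m \<and> delta m k =
        ereal (ln (2 * real m) powr \<theta> / (real k / real m * ln (ln (3 * real k / real m))) ^ (m - 1))"
      by (meson order_trans)
  qed simp
qed

end
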